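(* The dual space $H^1(\mathbb{T}^\infty)^*$ is not contained in $H^p(\mathbb{T}^\infty)$ for any $p>2$.
   Context: $\mathbb{T}^\infty$ is the countable product of unit circles with Haar measure $m_\infty$ (the product of normalized Lebesgue measures). A function $f\in L^1(\mathbb{T}^\infty)$ has Fourier series $\sum_\alpha \hat f(\alpha)z^\alpha$ over integer multi-indices $\alpha=(\alpha_1,\alpha_2,\dots)$ with only finitely many non-zero entries. For $1\le p\le\infty$, $H^p(\mathbb{T}^\infty)$ is the subspace of $f\in L^p(\mathbb{T}^\infty)$ with $\hat f(\alpha)=0$ unless all entries of $\alpha$ are $\ge 0$. The Riesz projection $P^+_\infty$ is the orthogonal projection of $L^2(\mathbb{T}^\infty)$ onto $H^2(\mathbb{T}^\infty)$. The dual $H^1(\mathbb{T}^\infty)^*$ is identified, through the $L^2(\mathbb{T}^\infty)$ pairing, with the space of analytic functions $P_\infty^+(L^\infty(\mathbb{T}^\infty))\subset H^2(\mathbb{T}^\infty)$. *)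

theory Defs
  imports "HOL-Probability.Probability"
begin

definition circle_measure :: "complex measure" where
  "circle_measure =
     distr (uniform_measure lborel {0..<2*pi}) (restrict_space borel (sphere 0 1)) cis"

definition haar_Tinf :: "(nat \<Rightarrow> complex) measure" where
  "haar_Tinf = (\<Pi>\<^sub>M j\<in>UNIV. circle_measure)"

text \<open>
  Function spaces are sets of functions, not of almost-everywhere classes; all the sets below
  are closed under almost-everywhere equality of measurable functions, so inclusions between them
  mean the same as for classes.
\<close>

definition Lp_Tinf :: "ennreal \<Rightarrow> ((nat \<Rightarrow> complex) \<Rightarrow> complex) set" where
  "Lp_Tinf p = {f \<in> borel_measurable haar_Tinf.
     if p = \<infinity> then \<exists>C. AE z in haar_Tinf. norm (f z) \<le> C
     else integrable haar_Tinf (\<lambda>z. norm (f z) powr enn2real p)}"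

definition multi_index :: "(nat \<Rightarrow> int) \<Rightarrow> bool" where
  "multi_index \<alpha> \<longleftrightarrow> finite {j. \<alpha> j \<noteq> 0}"

definition monomial :: "(nat \<Rightarrow> int) \<Rightarrow> (nat \<Rightarrow> complex) \<Rightarrow> complex" where
  "monomial \<alpha> z = (\<Prod>j | \<alpha> j \<noteq> 0. z j powi \<alpha> j)"

definition L2_pairing ::
    "((nat \<Rightarrow> complex) \<Rightarrow> complex) \<Rightarrow> ((nat \<Rightarrow> complex) \<Rightarrow> complex) \<Rightarrow> complex" where
  "L2_pairing f g = (LINT z|haar_Tinf. f z * cnj (g z))"

definition fourier_coeff :: "((nat \<Rightarrow> complex) \<Rightarrow> complex) \<Rightarrow> (nat \<Rightarrow> int) \<Rightarrow> complex" where
  "fourier_coeff f \<alpha> = L2_pairing f (monomial \<alpha>)"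

definition Hp_Tinf :: "ennreal \<Rightarrow> ((nat \<Rightarrow> complex) \<Rightarrow> complex) set" where
  "Hp_Tinf p = {f \<in> Lp_Tinf p.
     \<forall>\<alpha>. multi_index \<alpha> \<and> \<not> (\<forall>j. 0 \<le> \<alpha> j) \<longrightarrow> fourier_coeff f \<alpha> = 0}"

text \<open>
  The orthogonal projection of \<open>f\<close> onto \<open>H\<^sup>2\<close> is determined only up to almost-everywhere equality,
  so it is a relation: \<open>g\<close> lies in \<open>H\<^sup>2\<close> and \<open>f - g\<close> is orthogonal to \<open>H\<^sup>2\<close>.
\<close>

definition is_riesz_projection ::
    "((nat \<Rightarrow> complex) \<Rightarrow> complex) \<Rightarrow> ((nat \<Rightarrow> complex) \<Rightarrow> complex) \<Rightarrow> bool" where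
  "is_riesz_projection f g \<longleftrightarrow>
     f \<in> Lp_Tinf 2 \<and> g \<in> Hp_Tinf 2 \<and> (\<forall>h \<in> Hp_Tinf 2. L2_pairing (\<lambda>z. f z - g z) h = 0)"

definition riesz_image_Linf :: "((nat \<Rightarrow> complex) \<Rightarrow> complex) set" where
  "riesz_image_Linf = {g. \<exists>f \<in> Lp_Tinf \<infinity>. is_riesz_projection f g}"

text \<open>Only the values on \<open>H\<^sup>1\<close> matter; boundedness forces equal values on functions that agree
  almost everywhere.\<close>

definition bounded_functional_H1 :: "(((nat \<Rightarrow> complex) \<Rightarrow> complex) \<Rightarrow> complex) \<Rightarrow> bool" where
  "bounded_functional_H1 \<Lambda> \<longleftrightarrow>
     (\<forall>f \<in> Hp_Tinf 1. \<forall>g \<in> Hp_Tinf 1. \<Lambda> (\<lambda>z. f z + g z) = \<Lambda> f + \<Lambda> g) \<and>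
     (\<forall>f \<in> Hp_Tinf 1. \<forall>c. \<Lambda> (\<lambda>z. c * f z) = c * \<Lambda> f) \<and>
     (\<exists>C. \<forall>f \<in> Hp_Tinf 1. norm (\<Lambda> f) \<le> C * (LINT z|haar_Tinf. norm (f z)))"

text \<open>
  The dual of \<open>H\<^sup>1\<close> as a space of analytic functions: the functions in \<open>P\<^sup>+(L\<^sup>\<infinity>)\<close>, each standing
  for the bounded functional on \<open>H\<^sup>1\<close> that it represents through the \<open>L\<^sup>2\<close> pairing. The pairing
  integral need not converge on all of \<open>H\<^sup>1\<close>, so it is taken on the dense subspace \<open>H\<^sup>2\<close>.
  That the functional exists is automatic, see \<open>H1_dual_eq\<close> below.
\<close>

definition H1_dual :: "((nat \<Rightarrow> complex) \<Rightarrow> complex) set" where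
  "H1_dual = {g \<in> riesz_image_Linf.
     \<exists>\<Lambda>. bounded_functional_H1 \<Lambda> \<and> (\<forall>f \<in> Hp_Tinf 2. \<Lambda> f = L2_pairing f g)}"

lemma H1_dual_eq: "H1_dual = riesz_image_Linf"
proof
  show "H1_dual \<subseteq> riesz_image_Linf" by (auto simp: H1_dual_def)
  show "riesz_image_Linf \<subseteq> H1_dual"
  proof
    fix g assume g: "g \<in> riesz_image_Linf"
    then obtain \<psi> where psi: "\<psi> \<in> Lp_Tinf \<infinity>" and R: "is_riesz_projection \<psi> g"
      by (auto simp: riesz_image_Linf_def)
    obtain C where m: "\<psi> \<in> borel_measurable haar_Tinf"
      and C: "AE z in haar_Tinf. norm (\<psi> z) \<le> C"
      using psi by (auto simp: Lp_Tinf_def)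
    have cnj: "(\<lambda>z. u z * cnj (v z)) \<in> borel_measurable haar_Tinf"
      if "u \<in> borel_measurable haar_Tinf" "v \<in> borel_measurable haar_Tinf" for u v
      using that(1) measurable_compose[OF that(2) borel_measurable_continuous_onI[OF continuous_on_cnj[OF continuous_on_id]]]
      by (rule borel_measurable_times)
    define \<Lambda> where "\<Lambda> f = L2_pairing f \<psi>" for f
    have H1: "integrable haar_Tinf f" if "f \<in> Hp_Tinf 1" for f
      using that by (auto simp: Hp_Tinf_def Lp_Tinf_def intro: integrable_norm_cancel)
    have int: "integrable haar_Tinf (\<lambda>z. f z * cnj (\<psi> z))" if "integrable haar_Tinf f" for f
    proof (rule Bochner_Integration.integrable_bound[where f = "\<lambda>z. C * norm (f z)"])
      show "AE z in haar_Tinf. norm (f z * cnj (\<psi> z)) \<le> norm (C * norm (f z))"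
        using C
      proof eventually_elim
        case (elim z)
        have "norm (f z) * norm (\<psi> z) \<le> norm (f z) * \<bar>C\<bar>"
          using elim by (intro mult_left_mono) auto
        then show ?case by (simp add: norm_mult abs_mult mult.commute)
      qed
    qed (use that m cnj in auto)
    have sq: "integrable haar_Tinf (\<lambda>z. u z * cnj (v z))"
      if "u \<in> Lp_Tinf 2" "v \<in> Lp_Tinf 2" for u v
    proof (rule Bochner_Integration.integrable_bound
        [where f = "\<lambda>z. (norm (u z))\<^sup>2 + (norm (v z))\<^sup>2"])
      show "AE z in haar_Tinf. norm (u z * cnj (v z)) \<le> norm ((norm (u z))\<^sup>2 + (norm (v z))\<^sup>2)"
      proof (rule AE_I2)
        fix z
        have "2 * (norm (u z) * norm (v z)) \<le> (norm (u z))\<^sup>2 + (norm (v z))\<^sup>2"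
          using sum_squares_bound[of "norm (u z)" "norm (v z)"] by simp
        moreover have "0 \<le> norm (u z) * norm (v z)" by simp
        ultimately have "norm (u z) * norm (v z) \<le> (norm (u z))\<^sup>2 + (norm (v z))\<^sup>2"
          by linarith
        then show "norm (u z * cnj (v z)) \<le> norm ((norm (u z))\<^sup>2 + (norm (v z))\<^sup>2)"
          by (simp add: norm_mult)
      qed
    qed (use that in \<open>auto simp: Lp_Tinf_def intro!: cnj\<close>)
    have "bounded_functional_H1 \<Lambda>"
      unfolding bounded_functional_H1_def
    proof (intro conjI ballI allI exI)
      fix f h assume "f \<in> Hp_Tinf 1" "h \<in> Hp_Tinf 1"
      then show "\<Lambda> (\<lambda>z. f z + h z) = \<Lambda> f + \<Lambda> h"
        by (simp add: \<Lambda>_def L2_pairing_def distrib_right int H1)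
    next
      fix f c
      show "\<Lambda> (\<lambda>z. c * f z) = c * \<Lambda> f"
        by (simp add: \<Lambda>_def L2_pairing_def mult.assoc)
    next
      fix f assume f: "f \<in> Hp_Tinf 1"
      have "norm (\<Lambda> f) \<le> (LINT z|haar_Tinf. norm (f z * cnj (\<psi> z)))"
        by (simp only: \<Lambda>_def L2_pairing_def integral_norm_bound)
      also have "\<dots> \<le> (LINT z|haar_Tinf. \<bar>C\<bar> * norm (f z))"
      proof (rule integral_mono_AE)
        show "AE z in haar_Tinf. norm (f z * cnj (\<psi> z)) \<le> \<bar>C\<bar> * norm (f z)"
          using C
        proof eventually_elim
          case (elim z)
          have "norm (f z) * norm (\<psi> z) \<le> norm (f z) * \<bar>C\<bar>"
            using elim by (intro mult_left_mono) auto
          then show ?case by (simp add: norm_mult mult.commute)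
        qed
      qed (use int[OF H1[OF f]] H1[OF f] in auto)
      finally show "norm (\<Lambda> f) \<le> \<bar>C\<bar> * (LINT z|haar_Tinf. norm (f z))" by simp
    qed
    moreover have "\<Lambda> f = L2_pairing f g" if f: "f \<in> Hp_Tinf 2" for f
    proof -
      have L: "f \<in> Lp_Tinf 2" "g \<in> Lp_Tinf 2" "\<psi> \<in> Lp_Tinf 2"
        using f R by (auto simp: is_riesz_projection_def Hp_Tinf_def)
      have "(LINT z|haar_Tinf. (\<psi> z - g z) * cnj (f z)) = 0"
        using R f by (auto simp: is_riesz_projection_def L2_pairing_def)
      moreover have "(LINT z|haar_Tinf. f z * cnj (\<psi> z) - f z * cnj (g z)) =
          (LINT z|haar_Tinf. cnj ((\<psi> z - g z) * cnj (f z)))"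
        by (simp add: algebra_simps)
      moreover have "\<dots> = cnj (LINT z|haar_Tinf. (\<psi> z - g z) * cnj (f z))"
        by (rule Bochner_Integration.integral_cnj)
      ultimately have "(LINT z|haar_Tinf. f z * cnj (\<psi> z) - f z * cnj (g z)) = 0"
        by (simp only: complex_cnj_zero)
      then show ?thesis
        using sq[OF L(1,3)] sq[OF L(1,2)] by (simp add: \<Lambda>_def L2_pairing_def)
    qed
    ultimately show "g \<in> H1_dual" using g by (auto simp: H1_dual_def)
  qed
qed

end

theory Submission
  imports Defs
begin

text \<open>
  Fix a large \<open>n\<close> and a function \<open>\<tau>\<close> on the circle, close to the sign of the real part. A function of
  \<open>n\<close> circle variables that depends only on their values under \<open>\<tau>\<close> is a function on the cube
  \<open>{-1,1}\<^sup>n\<close>. The cube contains a set \<open>E\<close> of density about \<open>1/n\<close> whose \<open>n\<close> coordinate flips \<open>E\<^sub>j\<close> are pairwise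
  disjoint, so \<open>F = \<Sum>\<^sub>j u\<^sub>j 1(E\<^sub>j)\<close> with unimodular \<open>u\<^sub>j\<close> is bounded by 1. Let \<open>u\<^sub>j\<close> be an
  independent phase times a monomial of high degree in all cube variables other than the \<open>j\<close>-th.
  Then the Riesz projection acts on the \<open>j\<close>-th summand as the one-variable projection in its \<open>j\<close>-th
  variable, which smears mass from \<open>E\<^sub>j\<close> back to \<open>E\<close>: since \<open>P \<tau> = (\<tau> + i \<tau>')/2\<close> with \<open>\<tau>'\<close> real, the
  projected indicator has real part at least \<open>1/4\<close> on \<open>E\<close>. By orthogonality of the phases, \<open>PF\<close> has mean
  square at least \<open>n/16\<close> on \<open>E\<close>, hence \<open>\<parallel>PF\<parallel>\<^sub>p\<^sup>p\<close> is of order at least \<open>n\<^bsup>p/2 - 1\<^esup>\<close>, which is unbounded for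
  \<open>p > 2\<close>. A weighted sum of such functions with disjoint phases is a bounded function whose projection
  is not in \<open>L\<^sup>p\<close>. Taking \<open>\<tau>\<close> a trigonometric polynomial and replacing indicators by the multilinear
  polynomials extending them makes every projection an explicit finite sum.
\<close>

section \<open>Haar measure on the infinite torus\<close>

lemma space_circle_measure: "space circle_measure = sphere 0 1"
  by (simp add: circle_measure_def space_restrict_space)

lemma cis_measurable_circle:
  "cis \<in> measurable (uniform_measure lborel {0..<2*pi}) (restrict_space borel (sphere 0 1))"
proof (rule measurable_restrict_space2)
  have "cis \<in> borel_measurable borel"
    by (intro borel_measurable_continuous_onI) (simp add: continuous_on_cis)
  then show "cis \<in> uniform_measure lborel {0..<2*pi} \<rightarrow>\<^sub>M borel" by simp
qed simp

lemma prob_space_circle_measure: "prob_space circle_measure"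
proof -
  interpret prob_space "uniform_measure lborel {0..<2*pi}"
    by (rule prob_space_uniform_measure) auto
  show ?thesis
    unfolding circle_measure_def by (rule prob_space_distr[OF cis_measurable_circle])
qed

lemma borel_measurable_circle_measure:
  fixes f :: "complex \<Rightarrow> 'a::topological_space"
  assumes "continuous_on (sphere 0 1) f"
  shows "f \<in> borel_measurable circle_measure"
  using borel_measurable_continuous_on_restrict[OF assms]
  by (simp add: circle_measure_def)

lemma integral_circle_measure:
  fixes f :: "complex \<Rightarrow> 'a::{euclidean_space,second_countable_topology}"
  assumes f: "continuous_on (sphere 0 1) f"
  shows "integral\<^sup>L circle_measure f = (1 / (2*pi)) *\<^sub>R integral {0..2*pi} (\<lambda>t. f (cis t))"
proof -
  have m: "f \<in> borel_measurable (restrict_space borel (sphere 0 1))"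
    using assms by (rule borel_measurable_continuous_on_restrict)
  have c: "continuous_on A (\<lambda>t. f (cis t))" for A
    by (rule continuous_on_compose2[OF f]) (auto intro: continuous_on_cis)
  have [measurable]: "(\<lambda>t. f (cis t)) \<in> borel_measurable borel"
    using c by (rule borel_measurable_continuous_onI)
  have u: "uniform_measure lborel {0..<2*pi} =
      density lborel (\<lambda>t. ennreal (indicator {0..<2*pi} t / (2*pi)))"
    unfolding uniform_measure_def
    by (rule arg_cong[where f = "density lborel"]) (auto simp: fun_eq_iff indicator_def divide_ennreal ennreal_1[symmetric] simp del: ennreal_1)
  have "integral\<^sup>L circle_measure f = (LINT t|uniform_measure lborel {0..<2*pi}. f (cis t))"
    unfolding circle_measure_def by (rule integral_distr[OF cis_measurable_circle m])
  also have "\<dots> = (LINT t|lborel. (indicator {0..<2*pi} t / (2*pi)) *\<^sub>R f (cis t))"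
    unfolding u by (intro integral_density) auto
  also have "\<dots> = (LINT t|lborel. (1 / (2*pi)) *\<^sub>R (indicator {0..2*pi} t *\<^sub>R f (cis t)))"
  proof (rule integral_cong_AE)
    \<comment> \<open>The half-open and the closed interval differ only at the endpoint
      \<open>2*pi\<close>, a null set.\<close>
    have "AE t in lborel. t \<noteq> 2*pi" by (rule AE_lborel_singleton)
    then show "AE t in lborel. (indicator {0..<2*pi} t / (2*pi)) *\<^sub>R f (cis t) =
        (1 / (2*pi)) *\<^sub>R (indicator {0..2*pi} t *\<^sub>R f (cis t))"
      by eventually_elim (auto simp: indicator_def)
  qed measurable
  also have "\<dots> = (1 / (2*pi)) *\<^sub>R (LINT t:{0..2*pi}|lborel. f (cis t))"
    by (simp only: integral_scaleR_right set_lebesgue_integral_def)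
  also have "(LINT t:{0..2*pi}|lborel. f (cis t)) = integral {0..2*pi} (\<lambda>t. f (cis t))"
    by (rule set_borel_integral_eq_integral(2)) (simp add: borel_integrable_atLeastAtMost' c)
  finally show ?thesis .
qed

lemma continuous_on_power_int_circle: "continuous_on (sphere 0 1) (\<lambda>z::complex. z powi k)"
  by (intro continuous_intros) auto

lemma integral_circle_power_int:
  assumes "k \<noteq> 0"
  shows "(LINT z|circle_measure. z powi k) = 0"
proof -
  have "((\<lambda>t. cis (real_of_int k * t)) has_integral
      (cis (real_of_int k * (2*pi)) / (\<i> * of_int k) - cis (real_of_int k * 0) / (\<i> * of_int k))) {0..2*pi}"
  proof (rule fundamental_theorem_of_calculus)
    fix t assume "t \<in> {0..2*pi}"
    show "((\<lambda>t. cis (real_of_int k * t) / (\<i> * of_int k)) has_vector_derivative cis (real_of_int k * t))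
       (at t within {0..2*pi})"
      using assms by (auto intro!: derivative_eq_intros has_vector_derivative_real_field simp: cis_conv_exp field_simps)
  qed simp
  moreover have "cis (real_of_int k * (2*pi)) = 1"
    by (metis cis_multiple_2pi Ints_of_int mult.commute)
  ultimately have "integral {0..2*pi} (\<lambda>t. cis (real_of_int k * t)) = 0"
    by (simp add: integral_unique)
  then show ?thesis
    by (simp add: integral_circle_measure[OF continuous_on_power_int_circle] cis_power_int)
qed

section \<open>Coordinates and monomials on the torus\<close>

lemma prob_space_haar: "prob_space haar_Tinf"
  unfolding haar_Tinf_def by (intro prob_space_PiM prob_space_circle_measure)

interpretation haar: prob_space haar_Tinf
  by (rule prob_space_haar)

interpretation circle: product_prob_space "\<lambda>_::nat. circle_measure" UNIV
  using prob_space_circle_measure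
  by (auto simp: product_prob_space_def product_prob_space_axioms_def product_sigma_finite_def
      prob_space_imp_sigma_finite)

lemma space_haar: "space haar_Tinf = {z. \<forall>j. norm (z j) = 1}"
  by (auto simp: haar_Tinf_def space_PiM space_circle_measure PiE_def)

lemma norm_haar: "z \<in> space haar_Tinf \<Longrightarrow> norm (z j) = 1"
  by (simp add: space_haar)

lemma nonzero_haar: "z \<in> space haar_Tinf \<Longrightarrow> z j \<noteq> 0"
  by (auto dest: norm_haar[of z j])

lemma measurable_component_haar: "(\<lambda>z. z j) \<in> measurable haar_Tinf circle_measure"
  unfolding haar_Tinf_def by (rule measurable_component_singleton) simp

lemma measurable_continuous_component_haar:
  fixes f :: "complex \<Rightarrow> 'a::topological_space"
  assumes "continuous_on (sphere 0 1) f"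
  shows "(\<lambda>z. f (z j)) \<in> borel_measurable haar_Tinf"
  by (rule measurable_compose[OF measurable_component_haar borel_measurable_circle_measure[OF assms]])

lemma integral_component_haar:
  fixes f :: "complex \<Rightarrow> 'a::{banach,second_countable_topology}"
  assumes "continuous_on (sphere 0 1) f"
  shows "(LINT z|haar_Tinf. f (z j)) = integral\<^sup>L circle_measure f"
proof -
  have "distr haar_Tinf circle_measure (\<lambda>z. z j) = circle_measure"
    unfolding haar_Tinf_def by (rule circle.PiM_component) simp
  then show ?thesis
    using integral_distr[OF measurable_component_haar borel_measurable_circle_measure[OF assms]] by metis
qed

lemma monomial_measurable [measurable]: "monomial \<alpha> \<in> borel_measurable haar_Tinf"
  unfolding monomial_def
  by (intro borel_measurable_prod measurable_continuous_component_haar continuous_on_power_int_circle)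

lemma norm_monomial: "z \<in> space haar_Tinf \<Longrightarrow> norm (monomial \<alpha> z) = 1"
  by (simp add: monomial_def norm_haar prod_norm[symmetric] norm_power_int)

lemma monomial_superset:
  assumes "finite J" "{j. \<alpha> j \<noteq> 0} \<subseteq> J"
  shows "monomial \<alpha> z = (\<Prod>j\<in>J. z j powi \<alpha> j)"
  unfolding monomial_def using assms by (intro prod.mono_neutral_left) auto

lemma monomial_0: "monomial (\<lambda>_. 0) z = 1"
  by (simp add: monomial_def)

lemma monomial_single: "monomial (\<lambda>i. if i = j then k else 0) z = z j powi k"
  by (subst monomial_superset[where J = "{j}"]) auto

lemma multi_index_add: "multi_index \<alpha> \<Longrightarrow> multi_index \<beta> \<Longrightarrow> multi_index (\<lambda>j. \<alpha> j + \<beta> j)"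
  unfolding multi_index_def
  by (rule finite_subset[where B = "{j. \<alpha> j \<noteq> 0} \<union> {j. \<beta> j \<noteq> 0}"]) auto

lemma multi_index_uminus: "multi_index \<alpha> \<Longrightarrow> multi_index (\<lambda>j. - \<alpha> j)"
  by (simp add: multi_index_def)

lemma monomial_add:
  assumes "multi_index \<alpha>" "multi_index \<beta>" "z \<in> space haar_Tinf"
  shows "monomial (\<lambda>j. \<alpha> j + \<beta> j) z = monomial \<alpha> z * monomial \<beta> z"
proof -
  let ?J = "{j. \<alpha> j \<noteq> 0} \<union> {j. \<beta> j \<noteq> 0}"
  have J: "finite ?J" using assms by (simp add: multi_index_def)
  show ?thesis
    using J nonzero_haar[OF assms(3)]
    by (subst (1 2 3) monomial_superset[where J = ?J]) (auto simp: power_int_add prod.distrib)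
qed

lemma cnj_monomial:
  assumes "z \<in> space haar_Tinf"
  shows "cnj (monomial \<alpha> z) = monomial (\<lambda>j. - \<alpha> j) z"
proof -
  have "cnj (z j powi k) = z j powi (- k)" for j k
  proof -
    have "cnj (z j) = inverse (z j)"
      using norm_haar[OF assms, of j] complex_norm_square[of "z j"] nonzero_haar[OF assms, of j]
      by (simp add: field_simps)
    then show ?thesis by (simp add: power_int_minus power_int_inverse)
  qed
  then show ?thesis by (simp add: monomial_def)
qed

lemma integrable_bounded_haar:
  fixes f :: "(nat \<Rightarrow> complex) \<Rightarrow> 'a::{banach,second_countable_topology}"
  assumes "f \<in> borel_measurable haar_Tinf" "\<And>z. z \<in> space haar_Tinf \<Longrightarrow> norm (f z) \<le> B"
  shows "integrable haar_Tinf f"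
  using assms by (intro haar.integrable_const_bound[where B = B]) auto

text \<open>Only the finitely many coordinates in the support matter, so independence turns the
  integral into a product of circle integrals; a non-zero exponent makes one factor vanish.\<close>

lemma integral_monomial:
  assumes "multi_index \<alpha>"
  shows "(LINT z|haar_Tinf. monomial \<alpha> z) = (if \<alpha> = (\<lambda>_. 0) then 1 else 0)"
proof (cases "\<alpha> = (\<lambda>_. 0)")
  case False
  then obtain i where i: "\<alpha> i \<noteq> 0" by auto
  define J where "J = {j. \<alpha> j \<noteq> 0}"
  have J: "finite J" using assms by (simp add: J_def multi_index_def)
  have d: "distr haar_Tinf (PiM J (\<lambda>_. circle_measure)) (\<lambda>z. restrict z J) = PiM J (\<lambda>_. circle_measure)"
    unfolding haar_Tinf_def by (rule circle.distr_PiM_restrict_finite[OF J]) simp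
  have r: "(\<lambda>z. restrict z J) \<in> measurable haar_Tinf (PiM J (\<lambda>_. circle_measure))"
    unfolding haar_Tinf_def by (rule measurable_restrict_subset) simp
  have m: "(\<lambda>x. \<Prod>j\<in>J. x j powi \<alpha> j) \<in> borel_measurable (PiM J (\<lambda>_. circle_measure))"
    by (intro borel_measurable_prod measurable_compose[OF measurable_component_singleton]
        borel_measurable_circle_measure continuous_on_power_int_circle)
  have "(LINT z|haar_Tinf. monomial \<alpha> z) = (LINT z|haar_Tinf. (\<Prod>j\<in>J. (restrict z J) j powi \<alpha> j))"
    by (rule Bochner_Integration.integral_cong) (auto simp: monomial_def J_def)
  also have "\<dots> = (LINT x|PiM J (\<lambda>_. circle_measure). (\<Prod>j\<in>J. x j powi \<alpha> j))"
    using integral_distr[OF r m] d by metis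
  also have "\<dots> = (\<Prod>j\<in>J. LINT x|circle_measure. x powi \<alpha> j)"
  proof (rule circle.product_integral_prod[OF J])
    fix j
    show "integrable circle_measure (\<lambda>x. x powi \<alpha> j)"
      by (intro finite_measure.integrable_const_bound[where B = 1]
          prob_space.finite_measure[OF prob_space_circle_measure]
          borel_measurable_circle_measure continuous_on_power_int_circle)
        (auto simp: norm_power_int space_circle_measure)
  qed
  also have "\<dots> = 0"
    using i J integral_circle_power_int[OF i] by (auto simp: J_def intro!: prod_zero bexI[of _ i])
  finally show ?thesis using False by simp
qed (simp add: monomial_0 haar.prob_space)

section \<open>Trigonometric polynomials and the Riesz projection\<close>

text \<open>Trigonometric polynomials with spectrum in \<open>S\<close>, kept as a predicate so that
  spectra can be followed through sums, products and conjugates without coefficient families.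
  Identities are required only on the torus, where coordinates are non-zero and conjugation inverts
  them.\<close>

inductive trig :: "(nat \<Rightarrow> int) set \<Rightarrow> ((nat \<Rightarrow> complex) \<Rightarrow> complex) \<Rightarrow> bool" for S where
  zero: "(\<And>z. z \<in> space haar_Tinf \<Longrightarrow> f z = 0) \<Longrightarrow> trig S f"
| monomial: "\<alpha> \<in> S \<Longrightarrow> multi_index \<alpha> \<Longrightarrow>
    (\<And>z. z \<in> space haar_Tinf \<Longrightarrow> f z = c * monomial \<alpha> z) \<Longrightarrow> trig S f"
| add: "trig S f \<Longrightarrow> trig S g \<Longrightarrow> (\<And>z. z \<in> space haar_Tinf \<Longrightarrow> h z = f z + g z) \<Longrightarrow> trig S h"

lemma trig_cong:
  assumes "trig S f" "\<And>z. z \<in> space haar_Tinf \<Longrightarrow> g z = f z"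
  shows "trig S g"
  by (rule trig.add[OF assms(1) trig.zero[of "\<lambda>_. 0"]]) (simp_all add: assms(2))

lemma trig_mono: "trig S f \<Longrightarrow> S \<subseteq> S' \<Longrightarrow> trig S' f"
  by (induction rule: trig.induct) (blast intro: trig.intros)+

lemma trig_add: "trig S f \<Longrightarrow> trig S g \<Longrightarrow> trig S (\<lambda>z. f z + g z)"
  by (rule trig.add) auto

lemma trig_sum: "(\<And>i. i \<in> I \<Longrightarrow> trig S (f i)) \<Longrightarrow> trig S (\<lambda>z. \<Sum>i\<in>I. f i z)"
  by (induction I rule: infinite_finite_induct) (auto intro: trig.zero trig_add)

lemma trig_bounded:
  assumes "trig S f"
  shows "f \<in> borel_measurable haar_Tinf" "\<exists>B. \<forall>z\<in>space haar_Tinf. norm (f z) \<le> B"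
proof -
  have "f \<in> borel_measurable haar_Tinf \<and> (\<exists>B. \<forall>z\<in>space haar_Tinf. norm (f z) \<le> B)"
    using assms
  proof (induction rule: trig.induct)
    case (zero f)
    then show ?case by (auto cong: measurable_cong)
  next
    case (monomial \<alpha> f c)
    then have "f \<in> borel_measurable haar_Tinf \<longleftrightarrow> (\<lambda>z. c * monomial \<alpha> z) \<in> borel_measurable haar_Tinf"
      by (intro measurable_cong)
    moreover have "\<forall>z\<in>space haar_Tinf. norm (f z) \<le> norm c"
      using monomial by (simp add: norm_mult norm_monomial)
    ultimately show ?case by auto
  next
    case (add f g h)
    then obtain B C where "\<forall>z\<in>space haar_Tinf. norm (f z) \<le> B" "\<forall>z\<in>space haar_Tinf. norm (g z) \<le> C"
      by auto
    then have "\<forall>z\<in>space haar_Tinf. norm (h z) \<le> B + C"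
      using add.hyps by (simp add: norm_triangle_mono)
    moreover have "h \<in> borel_measurable haar_Tinf \<longleftrightarrow> (\<lambda>z. f z + g z) \<in> borel_measurable haar_Tinf"
      using add.hyps by (intro measurable_cong)
    ultimately show ?case using add.IH by auto
  qed
  then show "f \<in> borel_measurable haar_Tinf" "\<exists>B. \<forall>z\<in>space haar_Tinf. norm (f z) \<le> B"
    by auto
qed

lemma trig_integrable: "trig S f \<Longrightarrow> integrable haar_Tinf f"
  using trig_bounded[of S f] integrable_bounded_haar by blast

lemma trig_monomial: "\<alpha> \<in> S \<Longrightarrow> multi_index \<alpha> \<Longrightarrow> trig S (monomial \<alpha>)"
  by (rule trig.monomial[where c = 1]) auto

lemma trig_mult:
  assumes "trig A f" "trig B g" "\<And>\<alpha> \<beta>. \<alpha> \<in> A \<Longrightarrow> \<beta> \<in> B \<Longrightarrow> (\<lambda>j. \<alpha> j + \<beta> j) \<in> C"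
  shows "trig C (\<lambda>z. f z * g z)"
  using assms(1)
proof (induction rule: trig.induct)
  case (monomial \<alpha> f c)
  from assms(2) show ?case
  proof (induction rule: trig.induct)
    case (monomial \<beta> g d)
    then show ?case
      using \<open>\<alpha> \<in> A\<close> \<open>multi_index \<alpha>\<close> assms(3) monomial_add
      by (intro trig.monomial[where \<alpha> = "\<lambda>j. \<alpha> j + \<beta> j" and c = "c * d"])
        (auto simp: \<open>\<And>z. z \<in> space haar_Tinf \<Longrightarrow> f z = c * monomial \<alpha> z\<close> multi_index_add)
  next
    case (add g g' h)
    then show ?case by (intro trig.add[OF add.IH]) (simp add: distrib_left)
  qed (auto intro: trig.zero)
next
  case (add f f' h)
  then show ?case by (intro trig.add[OF add.IH]) (simp add: distrib_right)
qed (auto intro: trig.zero)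

lemma trig_const: "(\<lambda>_. 0) \<in> S \<Longrightarrow> trig S (\<lambda>_. c)"
  by (rule trig.monomial[where \<alpha> = "\<lambda>_. 0"]) (auto simp: monomial_0 multi_index_def)

lemma trig_scale: "trig S f \<Longrightarrow> trig S (\<lambda>z. c * f z)"
  using trig_mult[OF trig_const[of "{\<lambda>_. 0}" c], of S f S] by simp

lemma trig_prod:
  assumes "\<And>i. i \<in> I \<Longrightarrow> trig S (f i)" "(\<lambda>_. 0) \<in> S"
    "\<And>\<alpha> \<beta>. \<alpha> \<in> S \<Longrightarrow> \<beta> \<in> S \<Longrightarrow> (\<lambda>j. \<alpha> j + \<beta> j) \<in> S"
  shows "trig S (\<lambda>z. \<Prod>i\<in>I. f i z)"
  using assms(1)
  by (induction I rule: infinite_finite_induct) (auto intro!: trig_const assms(2) trig_mult assms(3))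

lemma trig_cnj:
  assumes "trig S f"
  shows "trig ((\<lambda>\<alpha> j. - \<alpha> j) ` S) (\<lambda>z. cnj (f z))"
  using assms
proof (induction rule: trig.induct)
  case (monomial \<alpha> f c)
  then show ?case
    by (intro trig.monomial[where \<alpha> = "\<lambda>j. - \<alpha> j" and c = "cnj c"])
      (auto simp: cnj_monomial multi_index_uminus)
next
  case (add f g h)
  then show ?case by (intro trig.add[OF add.IH]) simp
qed (auto intro: trig.zero)

lemma integral_trig_0:
  assumes "trig S f" "(\<lambda>_. 0) \<notin> S"
  shows "(LINT z|haar_Tinf. f z) = 0"
  using assms(1)
proof (induction rule: trig.induct)
  case (zero f)
  then show ?case by (simp cong: Bochner_Integration.integral_cong)
next
  case (monomial \<alpha> f c)
  then have "(LINT z|haar_Tinf. f z) = (LINT z|haar_Tinf. c * monomial \<alpha> z)"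
    by (intro Bochner_Integration.integral_cong) auto
  also have "\<dots> = 0" using integral_monomial[OF monomial(2)] monomial(1) assms(2) by auto
  finally show ?case .
next
  case (add f g h)
  then have "(LINT z|haar_Tinf. h z) = (LINT z|haar_Tinf. f z + g z)"
    by (intro Bochner_Integration.integral_cong) auto
  then show ?case using add trig_integrable by simp
qed

lemma Lp_2_iff:
  "f \<in> Lp_Tinf 2 \<longleftrightarrow> f \<in> borel_measurable haar_Tinf \<and> integrable haar_Tinf (\<lambda>z. (norm (f z))\<^sup>2)"
  by (auto simp: Lp_Tinf_def)

lemma bounded_Lp_2:
  assumes "f \<in> borel_measurable haar_Tinf" "\<And>z. z \<in> space haar_Tinf \<Longrightarrow> norm (f z) \<le> B"
  shows "f \<in> Lp_Tinf 2"
  unfolding Lp_2_iff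
  using assms by (auto intro!: integrable_bounded_haar[where B = "B\<^sup>2"] power_mono)

lemma trig_Lp_2: "trig S f \<Longrightarrow> f \<in> Lp_Tinf 2"
  using trig_bounded[of S f] bounded_Lp_2 by blast

lemma norm_mult_cnj_le: "norm (u * cnj v) \<le> (norm u)\<^sup>2 + (norm v)\<^sup>2"
proof -
  have "2 * (norm u * norm v) \<le> (norm u)\<^sup>2 + (norm v)\<^sup>2"
    using sum_squares_bound[of "norm u" "norm v"] by simp
  moreover have "0 \<le> norm u * norm v" by simp
  ultimately have "norm u * norm v \<le> (norm u)\<^sup>2 + (norm v)\<^sup>2" by linarith
  then show ?thesis by (simp add: norm_mult)
qed

lemma borel_measurable_cnj [measurable (raw)]:
  "f \<in> borel_measurable M \<Longrightarrow> (\<lambda>x. cnj (f x)) \<in> borel_measurable M"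
  by (rule measurable_compose[OF _ borel_measurable_continuous_onI[OF continuous_on_cnj[OF continuous_on_id]]])

lemma integrable_L2_pairing:
  assumes "u \<in> Lp_Tinf 2" "v \<in> Lp_Tinf 2"
  shows "integrable haar_Tinf (\<lambda>z. u z * cnj (v z))"
proof (rule Bochner_Integration.integrable_bound)
  show "integrable haar_Tinf (\<lambda>z. (norm (u z))\<^sup>2 + (norm (v z))\<^sup>2)"
    using assms by (simp add: Lp_2_iff)
  show "AE z in haar_Tinf. norm (u z * cnj (v z)) \<le> norm ((norm (u z))\<^sup>2 + (norm (v z))\<^sup>2)"
    using norm_mult_cnj_le by (intro AE_I2) simp
qed (use assms in \<open>auto simp: Lp_2_iff\<close>)

lemma L2_pairing_commute: "L2_pairing u v = cnj (L2_pairing v u)"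
  by (simp add: L2_pairing_def mult.commute flip: Bochner_Integration.integral_cnj)

lemma L2_pairing_diff_left:
  assumes "u \<in> Lp_Tinf 2" "v \<in> Lp_Tinf 2" "h \<in> Lp_Tinf 2"
  shows "L2_pairing (\<lambda>z. u z - v z) h = L2_pairing u h - L2_pairing v h"
  using integrable_L2_pairing[OF assms(1,3)] integrable_L2_pairing[OF assms(2,3)]
  by (simp add: L2_pairing_def left_diff_distrib)

lemma L2_pairing_trig:
  assumes "trig S f" "h \<in> Lp_Tinf 2" "\<And>\<alpha>. \<alpha> \<in> S \<Longrightarrow> multi_index \<alpha> \<Longrightarrow> fourier_coeff h \<alpha> = 0"
  shows "L2_pairing h f = 0"
  using assms(1)
proof (induction rule: trig.induct)
  case (zero f)
  then show ?case by (simp add: L2_pairing_def cong: Bochner_Integration.integral_cong)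
next
  case (monomial \<alpha> f c)
  then have "L2_pairing h f = (LINT z|haar_Tinf. cnj c * (h z * cnj (monomial \<alpha> z)))"
    unfolding L2_pairing_def by (intro Bochner_Integration.integral_cong) auto
  also have "\<dots> = cnj c * fourier_coeff h \<alpha>"
    by (simp add: fourier_coeff_def L2_pairing_def)
  finally show ?case using assms(3) monomial by simp
next
  case (add f g k)
  then have "L2_pairing h k = (LINT z|haar_Tinf. h z * cnj (f z) + h z * cnj (g z))"
    unfolding L2_pairing_def by (intro Bochner_Integration.integral_cong) (auto simp: distrib_left)
  also have "\<dots> = L2_pairing h f + L2_pairing h g"
    using add.hyps assms(2) by (simp add: L2_pairing_def integrable_L2_pairing trig_Lp_2)
  finally show ?case using add by simp
qed

definition analytic_indices :: "(nat \<Rightarrow> int) set" where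
  "analytic_indices = {\<alpha>. \<forall>j. 0 \<le> \<alpha> j}"

text \<open>Multiplying by the conjugate monomial shifts the spectrum by \<open>- \<alpha>\<close>;
  the shifted spectrum misses the zero index, so the integral vanishes.\<close>

lemma fourier_coeff_trig:
  assumes "trig S f" "multi_index \<alpha>" "\<alpha> \<notin> S"
  shows "fourier_coeff f \<alpha> = 0"
  unfolding fourier_coeff_def L2_pairing_def
proof (rule integral_trig_0)
  show "trig {\<lambda>j. \<beta> j + \<gamma> j |\<beta> \<gamma>. \<beta> \<in> S \<and> \<gamma> \<in> (\<lambda>\<alpha> j. - \<alpha> j) ` {\<alpha>}} (\<lambda>z. f z * cnj (monomial \<alpha> z))"
    by (rule trig_mult[OF assms(1) trig_cnj[OF trig_monomial]]) (use assms in auto)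
  show "(\<lambda>_. 0) \<notin> {\<lambda>j. \<beta> j + \<gamma> j |\<beta> \<gamma>. \<beta> \<in> S \<and> \<gamma> \<in> (\<lambda>\<alpha> j. - \<alpha> j) ` {\<alpha>}}"
  proof
    assume "(\<lambda>_. 0) \<in> {\<lambda>j. \<beta> j + \<gamma> j |\<beta> \<gamma>. \<beta> \<in> S \<and> \<gamma> \<in> (\<lambda>\<alpha> j. - \<alpha> j) ` {\<alpha>}}"
    then obtain \<beta> where "\<beta> \<in> S" "\<forall>j. 0 = \<beta> j + - \<alpha> j" by (auto simp: fun_eq_iff)
    then have "\<beta> = \<alpha>" by (auto simp: fun_eq_iff)
    then show False using assms(3) \<open>\<beta> \<in> S\<close> by simp
  qed
qed

lemma Hp_2_coeff: "h \<in> Hp_Tinf 2 \<Longrightarrow> multi_index \<alpha> \<Longrightarrow> \<alpha> \<notin> analytic_indices \<Longrightarrow> fourier_coeff h \<alpha> = 0"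
  by (auto simp: Hp_Tinf_def analytic_indices_def)

lemma trig_Hp_2: "trig analytic_indices g \<Longrightarrow> g \<in> Hp_Tinf 2"
  using trig_Lp_2[of analytic_indices g] fourier_coeff_trig[of analytic_indices g]
  by (auto simp: Hp_Tinf_def analytic_indices_def)

lemma antianalytic_pairing:
  assumes "trig (- analytic_indices) r" "h \<in> Hp_Tinf 2"
  shows "L2_pairing r h = 0"
  using L2_pairing_trig[OF assms(1), of h] Hp_2_coeff[OF assms(2)] assms(2) L2_pairing_commute[of r h]
  by (auto simp: Hp_Tinf_def)

text \<open>The difference of \<open>f\<close> and \<open>g\<close> is orthogonal to
  \<open>g\<close>, so the squared norm of \<open>g\<close> is the pairing of \<open>f\<close> with
  \<open>g\<close>. Bounding the real part of the integrand by half the sum of squares then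
  suffices.\<close>

lemma riesz_bessel:
  assumes g: "trig analytic_indices g" and r: "trig (- analytic_indices) (\<lambda>z. f z - g z)"
    and f: "f \<in> Lp_Tinf 2"
  shows "(LINT z|haar_Tinf. (norm (g z))\<^sup>2) \<le> (LINT z|haar_Tinf. (norm (f z))\<^sup>2)"
proof -
  note g2 = trig_Lp_2[OF g]
  have "L2_pairing f g = L2_pairing g g"
    using antianalytic_pairing[OF r trig_Hp_2[OF g]] L2_pairing_diff_left[OF f g2 g2] by simp
  moreover have "L2_pairing g g = (LINT z|haar_Tinf. complex_of_real ((norm (g z))\<^sup>2))"
    unfolding L2_pairing_def by (intro Bochner_Integration.integral_cong) (simp_all add: complex_norm_square del: of_real_power)
  ultimately have "(LINT z|haar_Tinf. (norm (g z))\<^sup>2) = Re (LINT z|haar_Tinf. f z * cnj (g z))"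
    by (simp add: L2_pairing_def del: of_real_power)
  also have "\<dots> = (LINT z|haar_Tinf. Re (f z * cnj (g z)))"
    using integral_Re[OF integrable_L2_pairing[OF f g2]] by (rule sym)
  also have "\<dots> \<le> (LINT z|haar_Tinf. ((norm (f z))\<^sup>2 + (norm (g z))\<^sup>2) / 2)"
  proof (rule integral_mono)
    show "Re (f z * cnj (g z)) \<le> ((norm (f z))\<^sup>2 + (norm (g z))\<^sup>2) / 2" for z
      using sum_squares_bound[of "norm (f z)" "norm (g z)"] complex_Re_le_cmod[of "f z * cnj (g z)"]
      by (simp add: norm_mult)
    show "integrable haar_Tinf (\<lambda>z. Re (f z * cnj (g z)))"
      by (rule integrable_Re[OF integrable_L2_pairing[OF f g2]])
  qed (use f g2 in \<open>auto simp: Lp_2_iff\<close>)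
  also have "\<dots> = ((LINT z|haar_Tinf. (norm (f z))\<^sup>2) + (LINT z|haar_Tinf. (norm (g z))\<^sup>2)) / 2"
    using f g2 by (simp add: Lp_2_iff)
  finally show ?thesis by simp
qed

section \<open>Series of projections\<close>

text \<open>Cauchy-Schwarz for the weights \<open>(1/2)^m\<close>, whose total mass is at most
  2.\<close>

lemma norm_weighted_sum_squared:
  fixes a :: "nat \<Rightarrow> complex"
  shows "(norm (\<Sum>m<k. (1/2)^m * a m))\<^sup>2 \<le> 2 * (\<Sum>m<k. (1/2)^m * (norm (a m))\<^sup>2)"
proof -
  have "norm (\<Sum>m<k. (1/2)^m * a m) \<le> (\<Sum>m<k. sqrt ((1/2)^m) * (sqrt ((1/2)^m) * norm (a m)))"
    by (rule order.trans[OF norm_sum]) (simp add: norm_mult norm_power flip: mult.assoc)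
  then have "(norm (\<Sum>m<k. (1/2)^m * a m))\<^sup>2 \<le> (\<Sum>m<k. sqrt ((1/2)^m) * (sqrt ((1/2)^m) * norm (a m)))\<^sup>2"
    by (intro power_mono) auto
  also have "\<dots> \<le> (\<Sum>m<k. (sqrt ((1/2)^m))\<^sup>2) * (\<Sum>m<k. (sqrt ((1/2)^m) * norm (a m))\<^sup>2)"
    by (rule Cauchy_Schwarz_ineq_sum)
  also have "\<dots> = (\<Sum>m<k. (1/2)^m) * (\<Sum>m<k. (1/2)^m * (norm (a m))\<^sup>2)"
    by (simp add: power_mult_distrib)
  also have "\<dots> \<le> 2 * (\<Sum>m<k. (1/2)^m * (norm (a m))\<^sup>2)"
  proof (rule mult_right_mono)
    have "(\<Sum>m<k. (1/2)^m) \<le> (\<Sum>m. (1/2)^m :: real)"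
      by (rule sum_le_suminf) auto
    then show "(\<Sum>m<k. (1/2)^m) \<le> (2::real)" by (simp add: suminf_geometric)
  qed (simp add: sum_nonneg)
  finally show ?thesis .
qed

text \<open>The weighted squares \<open>q m\<close> have summable integrals, so their sum
  \<open>Q\<close> is finite almost everywhere and integrable. Finiteness gives convergence of the
  series, and \<open>2 * Q\<close> dominates the squares of its partial sums, which makes the limit
  square integrable and permits dominated convergence in the pairings.\<close>

lemma weighted_series_L2:
  assumes L2: "\<And>m. g m \<in> Lp_Tinf 2"
    and le1: "\<And>m. (LINT z|haar_Tinf. (norm (g m z))\<^sup>2) \<le> 1"
  defines "G \<equiv> \<lambda>z. \<Sum>m. (1/2)^m * g m z"
  shows "G \<in> Lp_Tinf 2"
    and "h \<in> Lp_Tinf 2 \<Longrightarrow> (\<lambda>m. (1/2)^m * L2_pairing (g m) h) sums L2_pairing G h"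
proof -
  have [measurable]: "g m \<in> borel_measurable haar_Tinf" for m
    using L2 by (simp add: Lp_2_iff)
  have sq: "integrable haar_Tinf (\<lambda>z. (norm (g m z))\<^sup>2)" for m
    using L2 by (simp add: Lp_2_iff)
  define q where "q m z = (1/2)^m * (norm (g m z))\<^sup>2" for m z
  have q0: "0 \<le> q m z" for m z by (simp add: q_def)
  have qm [measurable]: "q m \<in> borel_measurable haar_Tinf" for m
    unfolding q_def by measurable
  have qi: "integrable haar_Tinf (q m)" for m
    unfolding q_def using sq by simp
  have qle: "(LINT z|haar_Tinf. q m z) \<le> (1/2)^m" for m
    using le1[of m] by (simp add: q_def mult_left_le)
  have sumq: "summable (\<lambda>m. LINT z|haar_Tinf. norm (q m z))"
  proof (rule summable_comparison_test')
    show "summable (\<lambda>m. (1/2)^m :: real)" by simp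
    show "norm (LINT z|haar_Tinf. norm (q m z)) \<le> (1/2)^m" for m
      using qle[of m] q0 by (simp add: abs_of_nonneg integral_nonneg_AE)
  qed
  have AEq: "AE z in haar_Tinf. summable (\<lambda>m. q m z)"
  proof -
    have "(\<integral>\<^sup>+z. (\<Sum>m. ennreal (q m z)) \<partial>haar_Tinf) = (\<Sum>m. \<integral>\<^sup>+z. ennreal (q m z) \<partial>haar_Tinf)"
      by (rule nn_integral_suminf) measurable
    also have "\<dots> = (\<Sum>m. ennreal (LINT z|haar_Tinf. q m z))"
      by (intro suminf_cong nn_integral_eq_integral qi) (simp add: q0)
    also have "\<dots> = ennreal (\<Sum>m. LINT z|haar_Tinf. q m z)"
      using sumq q0 by (intro suminf_ennreal2) (simp_all add: integral_nonneg_AE)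
    finally have "(\<integral>\<^sup>+z. (\<Sum>m. ennreal (q m z)) \<partial>haar_Tinf) \<noteq> \<infinity>" by simp
    then have "AE z in haar_Tinf. (\<Sum>m. ennreal (q m z)) \<noteq> \<infinity>"
      by (rule nn_integral_PInf_AE[rotated]) measurable
    then show ?thesis
      by eventually_elim (auto intro: summable_suminf_not_top q0)
  qed
  define Q where "Q z = (\<Sum>m. q m z)" for z
  have Qi: "integrable haar_Tinf Q"
    unfolding Q_def using AEq sumq qi q0 by (intro integrable_suminf) simp_all
  define s where "s k z = (\<Sum>m<k. (1/2)^m * g m z)" for k z
  have s2: "(norm (s k z))\<^sup>2 \<le> 2 * Q z" if "summable (\<lambda>m. q m z)" for k z
  proof -
    have "(norm (s k z))\<^sup>2 \<le> 2 * (\<Sum>m<k. q m z)"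
      unfolding s_def q_def by (rule norm_weighted_sum_squared)
    also have "(\<Sum>m<k. q m z) \<le> Q z"
      unfolding Q_def by (rule sum_le_suminf[OF that]) (auto simp: q0)
    finally show ?thesis by simp
  qed
  have lim: "(\<lambda>k. s k z) \<longlonglongrightarrow> G z" if "summable (\<lambda>m. q m z)" for z
  proof -
    have "summable (\<lambda>m. (1/2)^m * g m z)"
    proof (rule summable_comparison_test')
      show "summable (\<lambda>m. (1/2)^m + q m z)" using that by (intro summable_add) auto
      show "norm ((1/2)^m * g m z) \<le> (1/2)^m + q m z" for m
      proof -
        have "norm (g m z) \<le> 1 + (norm (g m z))\<^sup>2"
          using sum_squares_bound[of 1 "norm (g m z)"] norm_ge_zero[of "g m z"]
          by (simp del: norm_ge_zero)
        then have "(1/2)^m * norm (g m z) \<le> (1/2)^m * (1 + (norm (g m z))\<^sup>2)"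
          by (intro mult_left_mono) auto
        then show ?thesis by (simp add: q_def norm_mult norm_power distrib_left)
      qed
    qed
    then show ?thesis
      unfolding s_def G_def by (rule summable_LIMSEQ)
  qed
  have [measurable]: "G \<in> borel_measurable haar_Tinf"
    unfolding G_def by measurable
  have G2: "AE z in haar_Tinf. (norm (G z))\<^sup>2 \<le> 2 * Q z"
    using AEq
  proof eventually_elim
    case (elim z)
    show ?case
      by (rule LIMSEQ_le_const2[OF tendsto_power[OF tendsto_norm[OF lim[OF elim]]]])
        (use s2[OF elim] in auto)
  qed
  have "integrable haar_Tinf (\<lambda>z. (norm (G z))\<^sup>2)"
  proof (rule Bochner_Integration.integrable_bound)
    show "integrable haar_Tinf (\<lambda>z. 2 * Q z)" using Qi by simp
    show "AE z in haar_Tinf. norm ((norm (G z))\<^sup>2) \<le> norm (2 * Q z)"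
      using G2 by eventually_elim auto
  qed measurable
  then show "G \<in> Lp_Tinf 2" by (simp add: Lp_2_iff)
  assume h: "h \<in> Lp_Tinf 2"
  then have [measurable]: "h \<in> borel_measurable haar_Tinf" by (simp add: Lp_2_iff)
  have "(\<lambda>k. LINT z|haar_Tinf. s k z * cnj (h z)) \<longlonglongrightarrow> (LINT z|haar_Tinf. G z * cnj (h z))"
  proof (rule integral_dominated_convergence[where w = "\<lambda>z. 2 * Q z + (norm (h z))\<^sup>2"])
    show "integrable haar_Tinf (\<lambda>z. 2 * Q z + (norm (h z))\<^sup>2)"
      using Qi h by (simp add: Lp_2_iff)
    show "AE z in haar_Tinf. (\<lambda>k. s k z * cnj (h z)) \<longlonglongrightarrow> G z * cnj (h z)"
      using AEq by eventually_elim (auto intro: tendsto_mult_right lim)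
    show "AE z in haar_Tinf. norm (s k z * cnj (h z)) \<le> 2 * Q z + (norm (h z))\<^sup>2" for k
      using AEq
    proof eventually_elim
      case (elim z)
      show ?case using norm_mult_cnj_le[of "s k z" "h z"] s2[OF elim, of k] by simp
    qed
    show "(\<lambda>z. s k z * cnj (h z)) \<in> borel_measurable haar_Tinf" for k
      unfolding s_def by measurable
  qed measurable
  moreover have "(LINT z|haar_Tinf. s k z * cnj (h z)) = (\<Sum>m<k. (1/2)^m * L2_pairing (g m) h)" for k
    unfolding s_def L2_pairing_def
    using integrable_L2_pairing[OF L2 h] by (simp add: sum_distrib_right mult.assoc)
  ultimately show "(\<lambda>m. (1/2)^m * L2_pairing (g m) h) sums L2_pairing G h"
    by (simp add: sums_def L2_pairing_def)
qed

text \<open>The same weights sum the symbols to a bounded function and their projections to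
  \<open>G\<close>; \<open>riesz_bessel\<close> supplies the uniform norm bound for the second
  series. Analyticity and orthogonality pass to the limit because both are expressed by pairings,
  which commute with the series.\<close>

lemma riesz_image_series:
  assumes f: "\<And>m. f m \<in> borel_measurable haar_Tinf" "\<And>m z. z \<in> space haar_Tinf \<Longrightarrow> norm (f m z) \<le> 1"
    and g: "\<And>m. trig analytic_indices (g m)"
    and r: "\<And>m. trig (- analytic_indices) (\<lambda>z. f m z - g m z)"
  defines "G \<equiv> \<lambda>z. \<Sum>m. (1/2)^m * g m z"
  shows "G \<in> riesz_image_Linf" "G \<in> Lp_Tinf 2"
    and "h \<in> Lp_Tinf 2 \<Longrightarrow> (\<lambda>m. (1/2)^m * L2_pairing (g m) h) sums L2_pairing G h"
proof -
  define F where "F z = (\<Sum>m. (1/2)^m * f m z)" for z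
  have f2: "f m \<in> Lp_Tinf 2" for m using f by (rule bounded_Lp_2)
  have f1: "(LINT z|haar_Tinf. (norm (f m z))\<^sup>2) \<le> 1" for m
    using f2[of m] f(2)[of _ m]
    by (intro haar.integral_le_const) (auto simp: Lp_2_iff power_le_one)
  have g1: "(LINT z|haar_Tinf. (norm (g m z))\<^sup>2) \<le> 1" for m
    using riesz_bessel[OF g r f2] f1 by (rule order.trans)
  note g2 = trig_Lp_2[OF g]
  note FS = weighted_series_L2[of f, OF f2 f1, folded F_def[abs_def]]
  note GS = weighted_series_L2[of g, OF g2 g1, folded G_def]
  have "F \<in> Lp_Tinf \<infinity>"
  proof -
    have "norm (F z) \<le> 2" if z: "z \<in> space haar_Tinf" for z
    proof -
      have le: "norm ((1/2)^m * f m z) \<le> (1/2)^m" for m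
        using f(2)[OF z, of m] by (simp add: norm_mult norm_power mult_left_le)
      have "norm (F z) \<le> (\<Sum>m. (1/2)^m)"
        unfolding F_def by (rule norm_suminf_le[OF le]) simp
      then show ?thesis by (simp add: suminf_geometric)
    qed
    then show ?thesis using FS(1) by (auto simp: Lp_Tinf_def intro!: AE_I2)
  qed
  moreover have "G \<in> Hp_Tinf 2"
    unfolding Hp_Tinf_def
  proof (intro CollectI conjI allI impI)
    fix \<alpha> assume "multi_index \<alpha> \<and> \<not> (\<forall>j. 0 \<le> \<alpha> j)"
    then have a: "multi_index \<alpha>" "\<alpha> \<notin> analytic_indices" by (auto simp: analytic_indices_def)
    have "(\<lambda>m. (1/2)^m * L2_pairing (g m) (monomial \<alpha>)) sums L2_pairing G (monomial \<alpha>)"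
      using a by (intro GS(2) trig_Lp_2[of UNIV] trig_monomial) auto
    moreover have "L2_pairing (g m) (monomial \<alpha>) = 0" for m
      using fourier_coeff_trig[OF g a] by (simp add: fourier_coeff_def)
    ultimately show "fourier_coeff G \<alpha> = 0"
      by (simp add: fourier_coeff_def sums_unique2[OF _ sums_zero])
  qed (rule GS(1))
  moreover have "L2_pairing (\<lambda>z. F z - G z) h = 0" if h: "h \<in> Hp_Tinf 2" for h
  proof -
    have h2: "h \<in> Lp_Tinf 2" using h by (simp add: Hp_Tinf_def)
    have "L2_pairing (f m) h = L2_pairing (g m) h" for m
      using antianalytic_pairing[OF r h, of m] L2_pairing_diff_left[OF f2 g2 h2, of m m] by simp
    then have "L2_pairing F h = L2_pairing G h"
      using FS(2)[OF h2] GS(2)[OF h2] by (simp add: sums_unique2)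
    then show ?thesis using L2_pairing_diff_left[OF FS(1) GS(1) h2] by simp
  qed
  ultimately show "G \<in> riesz_image_Linf"
    using FS(1) f2 unfolding riesz_image_Linf_def is_riesz_projection_def by blast
  show "G \<in> Lp_Tinf 2"
    and "h \<in> Lp_Tinf 2 \<Longrightarrow> (\<lambda>m. (1/2)^m * L2_pairing (g m) h) sums L2_pairing G h"
    by (fact GS)+
qed

section \<open>Polynomials close to the sign\<close>

text \<open>The Newton-Schulz iteration for the sign. Its step is odd and maps [-1,1] to itself,
  with attracting fixed points 1 and -1.\<close>

primrec sgn_approx :: "nat \<Rightarrow> real \<Rightarrow> real" where
  "sgn_approx 0 x = x"
| "sgn_approx (Suc k) x = (3 * sgn_approx k x - (sgn_approx k x)^3) / 2"

lemma sgn_approx_poly: "\<exists>p. \<forall>x. sgn_approx k x = poly p x"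
proof (induction k)
  case 0
  show ?case by (rule exI[of _ "[:0, 1:]"]) simp
next
  case (Suc k)
  then obtain p where "\<forall>x. sgn_approx k x = poly p x" by blast
  then show ?case by (intro exI[of _ "smult (1/2) (smult 3 p - p ^ 3)"]) simp
qed

lemma sgn_approx_minus: "sgn_approx k (- x) = - sgn_approx k x"
  by (induction k) (simp_all add: power3_eq_cube field_simps)

text \<open>One iteration sends the defect \<open>y\<close> to
  \<open>y\<^sup>2 * ((3 + y) / 4)\<close>, which is at most \<open>y\<^sup>2\<close>. One factor
  \<open>y\<close> is bounded by the induction hypothesis and the other merely by
  \<open>1 - x\<^sup>2\<close>, enough for geometric decay.\<close>

lemma sgn_approx_defect:
  assumes "\<bar>x\<bar> \<le> 1"
  shows "0 \<le> 1 - (sgn_approx k x)\<^sup>2 \<and> 1 - (sgn_approx k x)\<^sup>2 \<le> (1 - x\<^sup>2) ^ Suc k"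
proof -
  have x: "0 \<le> 1 - x\<^sup>2" "1 - x\<^sup>2 \<le> 1" using assms by (simp_all add: abs_square_le_1)
  show ?thesis
  proof (induction k)
    case 0
    then show ?case using x by simp
  next
    case (Suc k)
    define y where "y = 1 - (sgn_approx k x)\<^sup>2"
    have y: "0 \<le> y" "y \<le> (1 - x\<^sup>2) ^ Suc k" "y \<le> 1" using Suc by (auto simp: y_def)
    have "1 - (sgn_approx (Suc k) x)\<^sup>2 = y\<^sup>2 * ((3 + y) / 4)"
      unfolding y_def by (simp add: power2_eq_square power3_eq_cube field_simps)
    moreover have "y\<^sup>2 * ((3 + y) / 4) \<le> y\<^sup>2 * 1" using y by (intro mult_left_mono) auto
    moreover have "0 \<le> y\<^sup>2 * ((3 + y) / 4)" using y by simp
    moreover have "y * y \<le> (1 - x\<^sup>2) ^ Suc k * (1 - x\<^sup>2)"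
    proof (rule mult_mono)
      have "(1 - x\<^sup>2) ^ Suc k \<le> 1 - x\<^sup>2"
        using power_le_one[OF x, of k] x by (simp add: mult_left_le)
      then show "y \<le> 1 - x\<^sup>2" using y by simp
    qed (use x y in auto)
    ultimately show ?case by (simp add: power2_eq_square mult_ac)
  qed
qed

lemma abs_sgn_approx_le_1: "\<bar>x\<bar> \<le> 1 \<Longrightarrow> \<bar>sgn_approx k x\<bar> \<le> 1"
  using sgn_approx_defect[of x k] by (simp add: abs_square_le_1)

text \<open>In the induction step, \<open>2 * Re \<zeta> * Re (poly Q \<zeta>)\<close> splits into
  the real parts of \<open>poly Q \<zeta>\<close> times \<open>\<zeta>\<close> and times its
  conjugate. On the circle the latter lowers exponents by one; the constant term \<open>b\<close>
  would become antianalytic and is traded for \<open>cnj b * \<zeta>\<close>, which has the same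
  real part.\<close>

lemma poly_Re_circle:
  fixes p :: "real poly"
  shows "\<exists>Q. \<forall>\<zeta>. norm \<zeta> = 1 \<longrightarrow> poly p (Re \<zeta>) = 2 * Re (poly Q \<zeta>)"
proof (induction p)
  case 0
  show ?case by (rule exI[of _ 0]) simp
next
  case (pCons a p)
  then obtain Q where Q: "\<And>\<zeta>. norm \<zeta> = 1 \<Longrightarrow> poly p (Re \<zeta>) = 2 * Re (poly Q \<zeta>)" by blast
  obtain b R where QR: "Q = pCons b R" by (cases Q)
  show ?case
  proof (intro exI[of _ "[:of_real a / 2:] + smult (1/2) (pCons 0 Q + R + [:0, cnj b:])"] allI impI)
    fix \<zeta> :: complex assume \<zeta>: "norm \<zeta> = 1"
    have "cnj \<zeta> * \<zeta> = 1" using complex_norm_square[of \<zeta>] \<zeta> by (simp add: mult.commute)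
    then have a: "cnj \<zeta> * poly Q \<zeta> = b * cnj \<zeta> + poly R \<zeta>"
      by (simp add: QR distrib_left flip: mult.assoc)
    have b: "Re (b * cnj \<zeta>) = Re (cnj b * \<zeta>)" by simp
    have "2 * Re \<zeta> * Re (poly Q \<zeta>) = Re (\<zeta> * poly Q \<zeta>) + Re (cnj \<zeta> * poly Q \<zeta>)"
      by (simp add: algebra_simps)
    then have "2 * Re \<zeta> * Re (poly Q \<zeta>) = Re (\<zeta> * poly Q \<zeta>) + Re (poly R \<zeta>) + Re (cnj b * \<zeta>)"
      unfolding a plus_complex.sel b by linarith
    then show "poly (pCons a p) (Re \<zeta>) =
        2 * Re (poly ([:of_real a / 2:] + smult (1/2) (pCons 0 Q + R + [:0, cnj b:])) \<zeta>)"
      using Q[OF \<zeta>] by (simp add: algebra_simps add_divide_distrib diff_divide_distrib)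
  qed
qed

text \<open>Since the approximant is odd, the polynomial may be replaced by its odd part, which has
  no constant term. Its conjugate then has only negative frequencies, and the polynomial itself is
  the one-variable Riesz projection.\<close>

lemma sgn_approx_circle:
  "\<exists>Q. coeff Q 0 = 0 \<and>
    (\<forall>\<zeta>. norm \<zeta> = 1 \<longrightarrow> complex_of_real (sgn_approx k (Re \<zeta>)) = poly Q \<zeta> + cnj (poly Q \<zeta>))"
proof -
  obtain Q where Q: "\<And>\<zeta>. norm \<zeta> = 1 \<Longrightarrow> sgn_approx k (Re \<zeta>) = 2 * Re (poly Q \<zeta>)"
    using sgn_approx_poly[of k] poly_Re_circle by metis
  define R where "R = smult (1/2) (Q - pcompose Q [:0, -1:])"
  show ?thesis
  proof (intro exI[of _ R] conjI allI impI)
    show "coeff R 0 = 0" by (simp add: R_def poly_0_coeff_0[symmetric] poly_pcompose)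
    fix \<zeta> :: complex assume \<zeta>: "norm \<zeta> = 1"
    have "sgn_approx k (Re \<zeta>) = (sgn_approx k (Re \<zeta>) - sgn_approx k (Re (- \<zeta>))) / 2"
      by (simp add: sgn_approx_minus)
    also have "\<dots> = 2 * Re (poly R \<zeta>)"
      using Q[of \<zeta>] Q[of "- \<zeta>"] \<zeta> by (simp add: R_def poly_pcompose field_simps)
    finally show "complex_of_real (sgn_approx k (Re \<zeta>)) = poly R \<zeta> + cnj (poly R \<zeta>)"
      by (simp add: complex_add_cnj)
  qed
qed

lemma AE_circle_Re_nonzero: "AE \<zeta> in circle_measure. Re \<zeta> \<noteq> 0"
proof -
  have "{t::real. cos t = 0} \<subseteq> range (\<lambda>n::int. of_int n * (pi/2))"
    by (auto simp: cos_zero_iff_int)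
  then have "countable {t::real. cos t = 0}"
    by (rule countable_subset) simp
  then have "{t::real. cos t = 0} \<in> null_sets lborel"
    by (rule countable_imp_null_set_lborel)
  then have "AE t::real in lborel. cos t \<noteq> 0"
    by (rule AE_I') auto
  then have "AE t in uniform_measure lborel {0..<2*pi}. cos t \<noteq> 0"
    by (intro AE_uniform_measureI) auto
  moreover have "{\<zeta> \<in> space (restrict_space borel (sphere 0 (1::real))). Re \<zeta> \<noteq> 0} \<in> sets (restrict_space borel (sphere 0 1))"
    using measurable_sets[OF measurable_restrict_space1[OF borel_measurable_Re], of "- {0}" "sphere 0 1"]
    by (simp add: vimage_def Int_def conj_commute)
  ultimately show ?thesis
    unfolding circle_measure_def by (subst AE_distr_iff[OF cis_measurable_circle]) auto
qed

lemma continuous_sgn_approx_Re: "continuous_on A (\<lambda>\<zeta>. sgn_approx k (Re \<zeta>))"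
  by (induction k) (auto intro!: continuous_intros)

text \<open>The defect is at most 1 and tends to 0 off the null set \<open>Re \<zeta> = 0\<close>,
  so dominated convergence applies on the circle. All coordinates have the same distribution, so one
  \<open>k\<close> serves every \<open>i\<close>.\<close>

lemma sgn_approx_defect_integral:
  assumes "0 < \<epsilon>"
  shows "\<exists>k. \<forall>i. (LINT z|haar_Tinf. 1 - (sgn_approx k (Re (z i)))\<^sup>2) \<le> \<epsilon>"
proof -
  have c: "continuous_on (sphere 0 1) (\<lambda>\<zeta>. 1 - (sgn_approx k (Re \<zeta>))\<^sup>2)" for k
    by (intro continuous_intros continuous_sgn_approx_Re)
  have re: "\<bar>Re \<zeta>\<bar> \<le> 1" if "\<zeta> \<in> space circle_measure" for \<zeta>
    using abs_Re_le_cmod[of \<zeta>] that by (simp add: space_circle_measure)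
  have "(\<lambda>k. LINT \<zeta>|circle_measure. 1 - (sgn_approx k (Re \<zeta>))\<^sup>2) \<longlonglongrightarrow> (LINT \<zeta>|circle_measure. 0)"
  proof (rule integral_dominated_convergence[where w = "\<lambda>_. 1"])
    show "integrable circle_measure (\<lambda>_. 1::real)"
      using prob_space.finite_measure[OF prob_space_circle_measure] by (simp add: finite_measure.integrable_const)
    have "AE \<zeta> in circle_measure. \<zeta> \<in> space circle_measure" by simp
    with AE_circle_Re_nonzero
    show "AE \<zeta> in circle_measure. (\<lambda>k. 1 - (sgn_approx k (Re \<zeta>))\<^sup>2) \<longlonglongrightarrow> 0"
    proof eventually_elim
      case (elim \<zeta>)
      have "(Re \<zeta>)\<^sup>2 \<le> 1" using re[OF elim(2)] by (simp add: abs_square_le_1)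
      then have "(\<lambda>k. (1 - (Re \<zeta>)\<^sup>2) ^ Suc k) \<longlonglongrightarrow> 0"
        using elim(1) by (intro LIMSEQ_Suc LIMSEQ_realpow_zero) auto
      then show ?case
        by (rule tendsto_sandwich[OF _ _ tendsto_const, rotated 2])
          (use sgn_approx_defect[OF re[OF elim(2)]] in auto)
    qed
    show "AE \<zeta> in circle_measure. norm (1 - (sgn_approx k (Re \<zeta>))\<^sup>2) \<le> 1" for k
      using sgn_approx_defect[OF re, of _ k] by (intro AE_I2) auto
  qed (use borel_measurable_circle_measure[OF c] in auto)
  then have "eventually (\<lambda>k. (LINT \<zeta>|circle_measure. 1 - (sgn_approx k (Re \<zeta>))\<^sup>2) < \<epsilon>) sequentially"
    using assms by (intro order_tendstoD(2)[of _ 0]) auto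
  then obtain k where "(LINT \<zeta>|circle_measure. 1 - (sgn_approx k (Re \<zeta>))\<^sup>2) < \<epsilon>"
    by (auto simp: eventually_sequentially)
  then show ?thesis
    using integral_component_haar[OF c[of k]] by (intro exI[of _ k]) auto
qed

section \<open>Sign patterns and a code with disjoint coordinate flips\<close>

definition bit_sign :: "nat set \<Rightarrow> nat \<Rightarrow> real" where
  "bit_sign S i = (if i \<in> S then 1 else -1)"

text \<open>The probability that independent random signs with means \<open>x i\<close> form the sign pattern of \<open>S\<close>.\<close>

definition pattern_weight :: "nat set \<Rightarrow> (nat \<Rightarrow> real) \<Rightarrow> nat set \<Rightarrow> real" where
  "pattern_weight I x S = (\<Prod>i\<in>I. (1 + bit_sign S i * x i) / 2)"

lemma sum_Pow_prod_if:
  fixes f g :: "'a \<Rightarrow> 'b::comm_semiring_1"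
  assumes "finite I"
  shows "(\<Sum>S\<in>Pow I. \<Prod>i\<in>I. if i \<in> S then f i else g i) = (\<Prod>i\<in>I. f i + g i)"
proof -
  have "(\<Prod>i\<in>I. if i \<in> S then f i else g i) = prod f S * prod g (I - S)" if "S \<in> Pow I" for S
    using that assms by (simp add: prod.If_cases Int_absorb1 Diff_eq)
  then show ?thesis using prod_add[OF assms, of f g] by simp
qed

lemma sum_pattern_weight: "finite I \<Longrightarrow> (\<Sum>S\<in>Pow I. pattern_weight I x S) = 1"
  using sum_Pow_prod_if[of I "\<lambda>i. (1 + x i) / 2" "\<lambda>i. (1 - x i) / 2"]
  by (simp add: pattern_weight_def bit_sign_def if_distrib[of "\<lambda>s. (1 + s * x i) / 2" for i] add_divide_distrib[symmetric] cong: if_cong)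

text \<open>For means in [-1,1] this is the probability that two independent random patterns
  coincide.\<close>

lemma sum_pattern_weight_squared:
  "finite I \<Longrightarrow> (\<Sum>S\<in>Pow I. (pattern_weight I x S)\<^sup>2) = (\<Prod>i\<in>I. (1 + (x i)\<^sup>2) / 2)"
proof -
  assume I: "finite I"
  have a: "(pattern_weight I x S)\<^sup>2 = (\<Prod>i\<in>I. if i \<in> S then ((1 + x i) / 2)\<^sup>2 else ((1 - x i) / 2)\<^sup>2)" for S
    unfolding pattern_weight_def prod_power_distrib
    by (rule prod.cong) (auto simp: bit_sign_def)
  have b: "((1 + x i) / 2)\<^sup>2 + ((1 - x i) / 2)\<^sup>2 = (1 + (x i)\<^sup>2) / 2" for i
    by (simp add: power2_eq_square field_simps)
  show ?thesis
    by (simp only: a sum_Pow_prod_if[OF I] b)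
qed

lemma pattern_weight_nonneg: "(\<And>i. i \<in> I \<Longrightarrow> \<bar>x i\<bar> \<le> 1) \<Longrightarrow> 0 \<le> pattern_weight I x S"
  unfolding pattern_weight_def bit_sign_def by (intro prod_nonneg) (force simp: abs_le_iff)

definition flip_bit :: "nat \<Rightarrow> nat set \<Rightarrow> nat set" where
  "flip_bit j S = (if j \<in> S then S - {j} else insert j S)"

lemma flip_bit_flip_bit [simp]: "flip_bit j (flip_bit j S) = S"
  by (auto simp: flip_bit_def)

lemma pattern_weight_remove:
  "finite I \<Longrightarrow> j \<in> I \<Longrightarrow>
    pattern_weight I x S = (1 + bit_sign S j * x j) / 2 * pattern_weight (I - {j}) x S"
  unfolding pattern_weight_def by (rule prod.remove)

lemma pattern_weight_flip_bit:
  assumes "finite I" "j \<in> I"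
  shows "pattern_weight I x (flip_bit j S) = (1 - bit_sign S j * x j) / 2 * pattern_weight (I - {j}) x S"
proof -
  have "pattern_weight (I - {j}) x (flip_bit j S) = pattern_weight (I - {j}) x S"
    unfolding pattern_weight_def by (rule prod.cong) (auto simp: bit_sign_def flip_bit_def)
  then show ?thesis
    by (simp add: pattern_weight_remove[OF assms] bit_sign_def) (simp add: flip_bit_def)
qed

text \<open>The Weierstrass product inequality.\<close>

lemma prod_ge_1_minus_sum:
  fixes y :: "'a \<Rightarrow> real"
  assumes "\<And>i. i \<in> I \<Longrightarrow> 0 \<le> y i \<and> y i \<le> 1"
  shows "1 - (\<Sum>i\<in>I. y i) \<le> (\<Prod>i\<in>I. 1 - y i)"
  using assms
proof (induction I rule: infinite_finite_induct)
  case (insert a I)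
  have "y a * (\<Prod>i\<in>I. 1 - y i) \<le> y a"
    using insert.prems by (intro mult_left_le prod_le_1) auto
  then show ?case using insert by (simp add: algebra_simps)
qed auto

text \<open>The Varshamov--Tenengolts code, with modulus large enough to correct a flip in either direction.\<close>

definition vt_code :: "nat \<Rightarrow> nat \<Rightarrow> nat set set" where
  "vt_code n a = {S \<in> Pow {..<n}. (\<Sum>i\<in>S. i + 1) mod (2 * n + 1) = a}"

text \<open>Flipping \<open>j\<close> changes the checksum by \<open>j + 1\<close> or its negative.
  Two code words with a common flip have checksums that differ by at most \<open>2 * n\<close> yet
  are congruent modulo \<open>2 * n + 1\<close>, so the two changes are equal; this identifies the
  position and then the word.\<close>

lemma inj_on_flip_vt_code: "inj_on (\<lambda>(j, S). flip_bit j S) ({..<n} \<times> vt_code n a)"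
proof -
  have "j = k \<and> S = T"
    if jk: "j \<in> {..<n}" "k \<in> {..<n}" and S: "S \<in> vt_code n a" and T: "T \<in> vt_code n a"
      and eq: "flip_bit j S = flip_bit k T" for j k S T
  proof -
    define U where "U = flip_bit j S"
    have fin: "finite S" "finite T" using S T by (auto simp: vt_code_def intro: finite_subset)
    have shift: "\<exists>\<sigma>\<in>{1, -1}. int (\<Sum>i\<in>V. i + 1) = int (\<Sum>i\<in>flip_bit l V. i + 1) + \<sigma> * (int l + 1)"
      if "finite V" for V l
    proof (cases "l \<in> V")
      case True
      then show ?thesis using that by (simp add: flip_bit_def sum.remove[of V l])
    next
      case False
      then show ?thesis using that by (simp add: flip_bit_def)
    qed
    obtain \<sigma> \<tau> where \<sigma>: "\<sigma> \<in> {1, -1::int}" "int (\<Sum>i\<in>S. i + 1) = int (\<Sum>i\<in>U. i + 1) + \<sigma> * (int j + 1)"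
      and \<tau>: "\<tau> \<in> {1, -1::int}" "int (\<Sum>i\<in>T. i + 1) = int (\<Sum>i\<in>U. i + 1) + \<tau> * (int k + 1)"
      using shift[OF fin(1), of j] shift[OF fin(2), of k] eq unfolding U_def by metis
    have "(\<Sum>i\<in>S. i + 1) mod (2 * n + 1) = (\<Sum>i\<in>T. i + 1) mod (2 * n + 1)"
      using S T by (simp add: vt_code_def)
    then have "int (\<Sum>i\<in>S. i + 1) mod int (2 * n + 1) = int (\<Sum>i\<in>T. i + 1) mod int (2 * n + 1)"
      by (simp only: zmod_int[symmetric])
    then have "int (2 * n + 1) dvd int (\<Sum>i\<in>S. i + 1) - int (\<Sum>i\<in>T. i + 1)"
      by (simp only: mod_eq_dvd_iff)
    then have "int (2 * n + 1) dvd \<sigma> * (int j + 1) - \<tau> * (int k + 1)"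
      unfolding \<sigma>(2) \<tau>(2) by (simp add: algebra_simps)
    moreover have "\<bar>\<sigma> * (int j + 1) - \<tau> * (int k + 1)\<bar> < int (2 * n + 1)"
      using \<sigma>(1) \<tau>(1) jk by auto
    ultimately have "\<sigma> * (int j + 1) - \<tau> * (int k + 1) = 0"
      using dvd_imp_le_int[of "\<sigma> * (int j + 1) - \<tau> * (int k + 1)" "int (2 * n + 1)"] by linarith
    \<comment> \<open>The shift by 1 keeps both magnitudes positive, so equal changes have equal
      signs.\<close>
    then have "j = k" using \<sigma>(1) \<tau>(1) by auto
    moreover have "S = flip_bit j U" by (simp add: U_def)
    moreover have "T = flip_bit k U" by (simp add: U_def eq)
    ultimately show ?thesis by simp
  qed
  then show ?thesis unfolding inj_on_def by fast
qed

section \<open>Projections of code indicators\<close>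

lemma trig_orthogonal:
  assumes "trig A f" "trig B h" "A \<inter> B = {}"
  shows "L2_pairing f h = 0"
  using L2_pairing_trig[OF assms(2) trig_Lp_2[OF assms(1)]] fourier_coeff_trig[OF assms(1)] assms(3)
  by blast

section \<open>Spectra of functions of one coordinate\<close>

definition single_index :: "nat \<Rightarrow> int \<Rightarrow> nat \<Rightarrow> int" where
  "single_index j k = (\<lambda>i. if i = j then k else 0)"

lemma trig_component:
  "single_index j k \<in> S \<Longrightarrow> trig S (\<lambda>z. c * z j powi k)"
  by (rule trig.monomial[where \<alpha> = "single_index j k"])
    (auto simp: single_index_def multi_index_def monomial_single)

lemma trig_component_power:
  "single_index j (int k) \<in> S \<Longrightarrow> trig S (\<lambda>z. c * z j ^ k)"
  using trig_component[of j "int k" S c] by simp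

lemma trig_power: "single_index j (int k) \<in> S \<Longrightarrow> trig S (\<lambda>z. z j ^ k)"
  using trig_component_power[of j k S 1] by simp

lemma cnj_power_haar: "z \<in> space haar_Tinf \<Longrightarrow> cnj (z j ^ k) = z j powi (- int k)"
  using cnj_monomial[of z "single_index j (int k)"]
    monomial_single[of j "int k" z] monomial_single[of j "- int k" z]
  by (simp add: single_index_def if_distrib[of uminus] cong: if_cong)

lemma trig_poly:
  assumes "\<And>k. single_index j (int k) \<in> S"
  shows "trig S (\<lambda>z. poly Q (z j))"
  unfolding poly_altdef by (intro trig_sum trig_component_power assms)

text \<open>Conjugation negates exponents on the circle, and the vanishing constant term excludes
  exponent 0.\<close>

lemma trig_cnj_poly:
  assumes "coeff Q 0 = 0" "\<And>k. k < 0 \<Longrightarrow> single_index j k \<in> S"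
  shows "trig S (\<lambda>z. cnj (poly Q (z j)))"
  unfolding poly_altdef cnj_sum
proof (rule trig_sum)
  fix k
  show "trig S (\<lambda>z. cnj (coeff Q k * z j ^ k))"
  proof (cases "k = 0")
    case True
    then show ?thesis using assms(1) by (intro trig.zero) simp
  next
    case False
    then have "trig S (\<lambda>z. cnj (coeff Q k) * z j powi (- int k))"
      by (intro trig_component assms(2)) simp
    then show ?thesis
      by (rule trig_cong) (simp add: cnj_power_haar del: complex_cnj_power)
  qed
qed

text \<open>Conjugation puts the exponents between \<open>- degree Q\<close> and 0; the extra power
  shifts them back to the nonnegative range.\<close>

lemma trig_power_cnj_poly:
  assumes "\<And>k. single_index j (int k) \<in> S"
  shows "trig S (\<lambda>z. z j ^ degree Q * cnj (poly Q (z j)))"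
  unfolding poly_altdef cnj_sum sum_distrib_left
proof (rule trig_sum)
  fix k assume "k \<in> {..degree Q}"
  then have k: "degree Q = (degree Q - k) + k" by simp
  have "trig S (\<lambda>z. cnj (coeff Q k) * z j ^ (degree Q - k))"
    by (rule trig_component_power[OF assms])
  then show "trig S (\<lambda>z. z j ^ degree Q * cnj (coeff Q k * z j ^ k))"
  proof (rule trig_cong)
    fix z assume "z \<in> space haar_Tinf"
    then have "norm (z j ^ k) = 1" by (simp add: norm_power norm_haar)
    then have "z j ^ k * cnj (z j ^ k) = 1"
      using complex_norm_square[of "z j ^ k"] by simp
    moreover have "z j ^ degree Q = z j ^ (degree Q - k) * z j ^ k"
      using k power_add by metis
    ultimately show "z j ^ degree Q * cnj (coeff Q k * z j ^ k) = cnj (coeff Q k) * z j ^ (degree Q - k)"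
      by (simp add: mult_ac del: complex_cnj_power)
  qed
qed

text \<open>Even coordinates carry the cube variables, odd coordinates the phases.\<close>

definition untagged :: "(nat \<Rightarrow> int) set" where
  "untagged = {\<alpha>. \<forall>i. odd i \<longrightarrow> \<alpha> i = 0}"

definition tagged :: "nat \<Rightarrow> (nat \<Rightarrow> int) set" where
  "tagged a = {\<alpha>. \<forall>i. odd i \<longrightarrow> \<alpha> i = (if i = a then 1 else 0)}"

lemma tagged_disjoint: "odd a \<Longrightarrow> a \<noteq> b \<Longrightarrow> tagged a \<inter> tagged b = {}"
  by (auto simp: tagged_def)

text \<open>\<open>E\<close> is the code, with \<open>E_inj\<close> the disjointness of its
  coordinate flips; \<open>Q\<close> is the analytic half of the approximate sign; \<open>w\<close>
  gives each summand its own phase coordinate.\<close>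

locale riesz_block =
  fixes n :: nat and w :: "nat \<Rightarrow> nat" and k :: nat and Q :: "complex poly" and E :: "nat set set"
  assumes w_odd: "\<And>j. j < n \<Longrightarrow> odd (w j)"
    and w_inj: "inj_on w {..<n}"
    and Q_0: "coeff Q 0 = 0"
    and Q_sgn: "\<And>\<zeta>. norm \<zeta> = 1 \<Longrightarrow> complex_of_real (sgn_approx k (Re \<zeta>)) = poly Q \<zeta> + cnj (poly Q \<zeta>)"
    and E_sub: "E \<subseteq> Pow {..<n}"
    and E_inj: "inj_on (\<lambda>(j, S). flip_bit j S) ({..<n} \<times> E)"
begin

definition sign_var :: "(nat \<Rightarrow> complex) \<Rightarrow> nat \<Rightarrow> real" where
  "sign_var z i = sgn_approx k (Re (z (2 * i)))"

text \<open>A phase times a monomial that outweighs every negative frequency of the other cube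
  variables; coordinate \<open>2 * j\<close> is left out so that the projection still acts on
  it.\<close>

definition carrier :: "nat \<Rightarrow> (nat \<Rightarrow> complex) \<Rightarrow> complex" where
  "carrier j z = z (w j) * (\<Prod>i\<in>{..<n} - {j}. z (2 * i) ^ degree Q)"

text \<open>The multilinear extension of the indicator of \<open>E\<close>, evaluated at the
  smoothed signs.\<close>

definition code_weight :: "(nat \<Rightarrow> complex) \<Rightarrow> real" where
  "code_weight z = (\<Sum>S\<in>E. pattern_weight {..<n} (sign_var z) S)"

definition symbol :: "(nat \<Rightarrow> complex) \<Rightarrow> complex" where
  "symbol z = (\<Sum>j<n. carrier j z * of_real (\<Sum>S\<in>E. pattern_weight {..<n} (sign_var z) (flip_bit j S)))"

text \<open>The flipped pattern has factor \<open>(1 - bit_sign S j * sign_var z j) / 2\<close> at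
  \<open>j\<close>; here the smoothed sign in that factor is replaced by its analytic half.\<close>

definition proj_coeff :: "nat \<Rightarrow> (nat \<Rightarrow> complex) \<Rightarrow> complex" where
  "proj_coeff j z = (\<Sum>S\<in>E. (1 - of_real (bit_sign S j) * poly Q (z (2 * j))) / 2 *
     of_real (pattern_weight ({..<n} - {j}) (sign_var z) S))"

definition proj :: "(nat \<Rightarrow> complex) \<Rightarrow> complex" where
  "proj z = (\<Sum>j<n. carrier j z * proj_coeff j z)"

definition carrier_sum :: "(nat \<Rightarrow> complex) \<Rightarrow> complex" where
  "carrier_sum z = (\<Sum>j<n. carrier j z)"

lemma abs_sign_var: "z \<in> space haar_Tinf \<Longrightarrow> \<bar>sign_var z i\<bar> \<le> 1"
  unfolding sign_var_def
  by (intro abs_sgn_approx_le_1) (metis abs_Re_le_cmod norm_haar)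

lemma sign_var_eq:
  "z \<in> space haar_Tinf \<Longrightarrow> of_real (sign_var z i) = poly Q (z (2 * i)) + cnj (poly Q (z (2 * i)))"
  unfolding sign_var_def by (rule Q_sgn) (rule norm_haar)

lemma weight_nonneg: "z \<in> space haar_Tinf \<Longrightarrow> 0 \<le> pattern_weight I (sign_var z) S"
  by (rule pattern_weight_nonneg) (rule abs_sign_var)

lemma norm_carrier: "z \<in> space haar_Tinf \<Longrightarrow> norm (carrier j z) = 1"
  by (simp add: carrier_def norm_mult norm_haar prod_norm[symmetric] norm_power)

lemma code_weight_bounds:
  assumes "z \<in> space haar_Tinf"
  shows "0 \<le> code_weight z" "code_weight z \<le> 1"
proof -
  show "0 \<le> code_weight z"
    unfolding code_weight_def by (intro sum_nonneg weight_nonneg[OF assms])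
  have "code_weight z \<le> (\<Sum>S\<in>Pow {..<n}. pattern_weight {..<n} (sign_var z) S)"
    unfolding code_weight_def using E_sub by (intro sum_mono2) (auto intro: weight_nonneg[OF assms])
  then show "code_weight z \<le> 1" by (simp add: sum_pattern_weight)
qed

text \<open>The carriers are unimodular and the patterns \<open>flip_bit j S\<close> are distinct by
  \<open>E_inj\<close>, so the weights add up to at most the total probability 1.\<close>

lemma norm_symbol:
  assumes z: "z \<in> space haar_Tinf"
  shows "norm (symbol z) \<le> 1"
proof -
  have sub: "flip_bit j S \<subseteq> {..<n}" if "S \<in> E" "j < n" for j S
    using that E_sub by (auto simp: flip_bit_def)
  have "norm (symbol z) \<le> (\<Sum>j<n. \<Sum>S\<in>E. pattern_weight {..<n} (sign_var z) (flip_bit j S))"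
    unfolding symbol_def
    by (rule order.trans[OF norm_sum])
      (simp add: norm_mult norm_carrier[OF z] sum_nonneg weight_nonneg[OF z] del: of_real_sum)
  also have "\<dots> = (\<Sum>T\<in>(\<lambda>(j, S). flip_bit j S) ` ({..<n} \<times> E). pattern_weight {..<n} (sign_var z) T)"
    by (subst sum.reindex[OF E_inj]) (simp add: sum.cartesian_product case_prod_beta)
  also have "\<dots> \<le> (\<Sum>S\<in>Pow {..<n}. pattern_weight {..<n} (sign_var z) S)"
    using sub by (intro sum_mono2) (auto intro: weight_nonneg[OF z])
  finally show ?thesis by (simp add: sum_pattern_weight)
qed

text \<open>The real part of \<open>Q\<close> is half the smoothed sign, so the factor at
  \<open>j\<close> has real part at least 1/4, whereas its counterpart in
  \<open>code_weight z / 4\<close> is at most 1/4. The remaining factors agree and are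
  nonnegative.\<close>

lemma Re_proj_coeff_ge:
  assumes z: "z \<in> space haar_Tinf" and j: "j < n"
  shows "code_weight z / 4 \<le> Re (proj_coeff j z)"
proof -
  have "code_weight z / 4 = (\<Sum>S\<in>E. pattern_weight {..<n} (sign_var z) S / 4)"
    by (simp add: code_weight_def sum_divide_distrib)
  also have "\<dots> \<le> (\<Sum>S\<in>E. Re ((1 - of_real (bit_sign S j) * poly Q (z (2 * j))) / 2 *
     of_real (pattern_weight ({..<n} - {j}) (sign_var z) S)))"
  proof (rule sum_mono)
    fix S
    let ?\<sigma> = "bit_sign S j" and ?x = "sign_var z j"
    let ?p = "pattern_weight ({..<n} - {j}) (sign_var z) S"
    define c where "c = (1 - of_real ?\<sigma> * poly Q (z (2 * j))) / 2"
    have "2 * Re (poly Q (z (2 * j))) = ?x"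
      using arg_cong[OF sign_var_eq[OF z, of j], of Re] by simp
    then have Re: "Re c = (1 - ?\<sigma> * ?x / 2) / 2"
      by (simp add: c_def field_simps)
    have "\<bar>?x\<bar> \<le> 1" by (rule abs_sign_var[OF z])
    then have "(1 + ?\<sigma> * ?x) / 2 / 4 \<le> Re c"
      by (auto simp: Re bit_sign_def)
    then have "(1 + ?\<sigma> * ?x) / 2 / 4 * ?p \<le> Re c * ?p"
      by (rule mult_right_mono[OF _ weight_nonneg[OF z]])
    moreover have "pattern_weight {..<n} (sign_var z) S = (1 + ?\<sigma> * ?x) / 2 * ?p"
      using j by (intro pattern_weight_remove) auto
    ultimately have "pattern_weight {..<n} (sign_var z) S / 4 \<le> Re (c * of_real ?p)"
      by simp
    then show "pattern_weight {..<n} (sign_var z) S / 4 \<le>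
        Re ((1 - of_real ?\<sigma> * poly Q (z (2 * j))) / 2 * of_real ?p)"
      unfolding c_def .
  qed
  also have "\<dots> = Re (proj_coeff j z)"
    by (simp only: proj_coeff_def Re_sum)
  finally show ?thesis .
qed

lemma trig_sign_var:
  assumes "\<And>m. single_index (2 * i) m \<in> S"
  shows "trig S (\<lambda>z. of_real (sign_var z i))"
  by (rule trig.add[OF trig_poly[of "2 * i" S Q] trig_cnj_poly[OF Q_0, of "2 * i" S]])
    (use assms sign_var_eq in auto)

lemma single_untagged: "single_index (2 * i) m \<in> untagged"
  by (auto simp: single_index_def untagged_def)

lemma trig_pattern_weight: "trig untagged (\<lambda>z. of_real (pattern_weight I (sign_var z) S))"
proof -
  have "trig untagged (\<lambda>z. \<Prod>i\<in>I. (1/2) * (1 + of_real (bit_sign S i) * of_real (sign_var z i)))"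
    by (intro trig_prod trig_scale trig_add trig_const trig_sign_var single_untagged)
      (auto simp: untagged_def)
  then show ?thesis
    by (rule trig_cong) (simp add: pattern_weight_def)
qed

lemma trig_code_weight: "trig untagged (\<lambda>z. of_real (code_weight z))"
  unfolding code_weight_def of_real_sum by (intro trig_sum trig_pattern_weight)

lemma trig_proj_coeff: "trig untagged (proj_coeff j)"
proof -
  have "trig untagged (\<lambda>z. \<Sum>S\<in>E. (1/2 + (- of_real (bit_sign S j) / 2) * poly Q (z (2 * j))) *
     of_real (pattern_weight ({..<n} - {j}) (sign_var z) S))"
    by (intro trig_sum trig_mult[OF _ trig_pattern_weight, of untagged] trig_add trig_const trig_scale trig_poly single_untagged)
      (auto simp: untagged_def)
  then show ?thesis
    by (rule trig_cong) (simp add: proj_coeff_def diff_divide_distrib)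
qed

lemma trig_carrier: "j < n \<Longrightarrow> trig (tagged (w j)) (carrier j)"
proof -
  assume j: "j < n"
  have "trig (tagged (w j)) (\<lambda>z. z (w j) ^ 1 * (\<Prod>i\<in>{..<n} - {j}. z (2 * i) ^ degree Q))"
    by (rule trig_mult[where A = "tagged (w j)" and B = untagged], rule trig_power,
        simp add: tagged_def single_index_def, rule trig_prod, rule trig_power, rule single_untagged)
      (auto simp: untagged_def tagged_def)
  then show ?thesis
    by (rule trig_cong) (simp add: carrier_def)
qed

lemma trig_carrier_mult:
  "j < n \<Longrightarrow> trig untagged a \<Longrightarrow> trig (tagged (w j)) (\<lambda>z. carrier j z * a z)"
  by (rule trig_mult[OF trig_carrier]) (auto simp: untagged_def tagged_def)

text \<open>Each factor of the weight has frequencies at least \<open>- degree Q\<close> in its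
  variable, which the carrier compensates. Neither function involves coordinate
  \<open>2 * j\<close>, hence the exponent 0 there.\<close>

lemma trig_carrier_pattern_weight:
  assumes "j < n"
  shows "trig {\<alpha> \<in> analytic_indices. \<alpha> (2 * j) = 0}
    (\<lambda>z. carrier j z * of_real (pattern_weight ({..<n} - {j}) (sign_var z) S))"
    (is "trig ?A _")
proof -
  have s: "single_index (2 * i) (int m) \<in> ?A" if "i \<noteq> j" for i m
    using that by (auto simp: single_index_def analytic_indices_def)
  have f: "trig ?A (\<lambda>z. (1/2) * z (2 * i) ^ degree Q + (of_real (bit_sign S i) / 2) *
      (z (2 * i) ^ degree Q * poly Q (z (2 * i)) + z (2 * i) ^ degree Q * cnj (poly Q (z (2 * i)))))"
    if "i \<noteq> j" for i
  proof (intro trig_add trig_scale trig_power trig_power_cnj_poly s that)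
    have "trig ?A (\<lambda>z. poly (monom 1 (degree Q) * Q) (z (2 * i)))"
      by (intro trig_poly s that)
    then show "trig ?A (\<lambda>z. z (2 * i) ^ degree Q * poly Q (z (2 * i)))"
      by (simp add: poly_monom)
  qed
  have "trig ?A (\<lambda>z. z (w j) ^ 1 * (\<Prod>i\<in>{..<n} - {j}. (1/2) * z (2 * i) ^ degree Q +
      (of_real (bit_sign S i) / 2) *
      (z (2 * i) ^ degree Q * poly Q (z (2 * i)) + z (2 * i) ^ degree Q * cnj (poly Q (z (2 * i))))))"
  proof (rule trig_mult[where A = ?A and B = ?A])
    have "w j \<noteq> 2 * j" using w_odd[OF assms] by auto
    then show "trig ?A (\<lambda>z. z (w j) ^ 1)"
      by (intro trig_power) (auto simp: single_index_def analytic_indices_def)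
  qed (rule trig_prod, rule f, auto simp: analytic_indices_def)
  then show ?thesis
  proof (rule trig_cong)
    fix z assume z: "z \<in> space haar_Tinf"
    have e: "z (2 * i) ^ degree Q * (of_real ((1 + bit_sign S i * sign_var z i) / 2)) =
      (1/2) * z (2 * i) ^ degree Q + (of_real (bit_sign S i) / 2) *
      (z (2 * i) ^ degree Q * poly Q (z (2 * i)) + z (2 * i) ^ degree Q * cnj (poly Q (z (2 * i))))" for i
      using sign_var_eq[OF z, of i] by (simp add: field_simps)
    then show "carrier j z * of_real (pattern_weight ({..<n} - {j}) (sign_var z) S) =
      z (w j) ^ 1 * (\<Prod>i\<in>{..<n} - {j}. (1/2) * z (2 * i) ^ degree Q +
      (of_real (bit_sign S i) / 2) *
      (z (2 * i) ^ degree Q * poly Q (z (2 * i)) + z (2 * i) ^ degree Q * cnj (poly Q (z (2 * i)))))"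
      by (simp only: carrier_def pattern_weight_def of_real_prod mult.assoc prod.distrib[symmetric] e power_one_right)
  qed
qed

lemma trig_proj: "trig analytic_indices proj"
proof -
  have "trig analytic_indices (\<lambda>z. \<Sum>j<n. \<Sum>S\<in>E.
      (carrier j z * of_real (pattern_weight ({..<n} - {j}) (sign_var z) S)) *
      (1/2 + (- of_real (bit_sign S j) / 2) * poly Q (z (2 * j))))"
    by (intro trig_sum trig_mult[OF trig_carrier_pattern_weight, where B = analytic_indices]
        trig_add trig_const trig_scale trig_poly)
      (auto simp: analytic_indices_def single_index_def)
  then show ?thesis
    by (rule trig_cong) (simp add: proj_def proj_coeff_def sum_distrib_left diff_divide_distrib mult_ac)
qed

text \<open>Only the antianalytic half at coordinate \<open>2 * j\<close> survives in the
  \<open>j\<close>-th difference. The other factors have exponent 0 there, so every index is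
  negative at \<open>2 * j\<close>.\<close>

lemma trig_symbol_minus_proj: "trig (- analytic_indices) (\<lambda>z. symbol z - proj z)"
proof -
  let ?B = "\<lambda>j. {single_index (2 * j) m |m. m < 0}"
  have "trig (- analytic_indices) (\<lambda>z. \<Sum>j<n. \<Sum>S\<in>E.
      (carrier j z * of_real (pattern_weight ({..<n} - {j}) (sign_var z) S)) *
      ((- of_real (bit_sign S j) / 2) * cnj (poly Q (z (2 * j)))))"
  proof (intro trig_sum)
    fix j S assume "j \<in> {..<n}" "S \<in> E"
    then show "trig (- analytic_indices) (\<lambda>z.
      (carrier j z * of_real (pattern_weight ({..<n} - {j}) (sign_var z) S)) *
      ((- of_real (bit_sign S j) / 2) * cnj (poly Q (z (2 * j)))))"
      by (intro trig_mult[OF trig_carrier_pattern_weight, where B = "?B j"] trig_scale trig_cnj_poly Q_0)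
        (auto simp: analytic_indices_def single_index_def not_le intro!: exI[of _ "2 * j"])
  qed
  then show ?thesis
  proof (rule trig_cong)
    fix z assume z: "z \<in> space haar_Tinf"
    have "carrier j z * (\<Sum>S\<in>E. of_real (pattern_weight {..<n} (sign_var z) (flip_bit j S))) -
      carrier j z * proj_coeff j z = (\<Sum>S\<in>E.
      (carrier j z * of_real (pattern_weight ({..<n} - {j}) (sign_var z) S)) *
      ((- of_real (bit_sign S j) / 2) * cnj (poly Q (z (2 * j)))))" if "j < n" for j
      unfolding proj_coeff_def right_diff_distrib[symmetric] sum_subtractf[symmetric] sum_distrib_left
      by (rule sum.cong[OF refl], subst pattern_weight_flip_bit)
        (use that in \<open>auto simp: sign_var_eq[OF z] field_simps\<close>)
    then show "symbol z - proj z = (\<Sum>j<n. \<Sum>S\<in>E.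
      (carrier j z * of_real (pattern_weight ({..<n} - {j}) (sign_var z) S)) *
      ((- of_real (bit_sign S j) / 2) * cnj (poly Q (z (2 * j)))))"
      by (simp add: symbol_def proj_def sum_subtractf[symmetric])
  qed
qed

text \<open>Cross terms vanish because their phases differ; in a diagonal term the unimodular
  carrier cancels.\<close>

lemma L2_pairing_carriers:
  assumes a: "\<And>j. trig untagged (a j)" and b: "\<And>j. trig untagged (b j)"
  shows "L2_pairing (\<lambda>z. \<Sum>j<n. carrier j z * a j z) (\<lambda>z. \<Sum>j<n. carrier j z * b j z) =
    (\<Sum>j<n. LINT z|haar_Tinf. a j z * cnj (b j z))"
proof -
  note L = trig_Lp_2[OF trig_carrier_mult]
  have "L2_pairing (\<lambda>z. \<Sum>j<n. carrier j z * a j z) (\<lambda>z. \<Sum>j<n. carrier j z * b j z) =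
    (\<Sum>j<n. \<Sum>l<n. L2_pairing (\<lambda>z. carrier j z * a j z) (\<lambda>z. carrier l z * b l z))"
    unfolding L2_pairing_def cnj_sum sum_product
    using integrable_L2_pairing[OF L[OF _ a] L[OF _ b]]
    by (subst Bochner_Integration.integral_sum)
      (force intro: Bochner_Integration.integrable_sum, intro sum.cong refl Bochner_Integration.integral_sum, force)
  also have "\<dots> = (\<Sum>j<n. \<Sum>l<n. if l = j then LINT z|haar_Tinf. a j z * cnj (b j z) else 0)"
  proof (intro sum.cong refl)
    fix j l assume jl: "j \<in> {..<n}" "l \<in> {..<n}"
    show "L2_pairing (\<lambda>z. carrier j z * a j z) (\<lambda>z. carrier l z * b l z) =
      (if l = j then LINT z|haar_Tinf. a j z * cnj (b j z) else 0)"
    proof (cases "l = j")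
      case True
      have "carrier j z * a j z * cnj (carrier j z * b j z) = a j z * cnj (b j z)"
        if "z \<in> space haar_Tinf" for z
      proof -
        have "carrier j z * cnj (carrier j z) = 1"
          using complex_norm_square[of "carrier j z"] norm_carrier[OF that, of j] by simp
        then show ?thesis by (simp add: mult_ac)
      qed
      then show ?thesis
        unfolding L2_pairing_def using True by (auto intro: Bochner_Integration.integral_cong)
    next
      case False
      then have "tagged (w j) \<inter> tagged (w l) = {}"
        using jl w_inj w_odd by (intro tagged_disjoint) (auto dest: inj_onD)
      then show ?thesis
        using False jl by (simp add: trig_orthogonal[OF trig_carrier_mult[OF _ a] trig_carrier_mult[OF _ b]])
    qed
  qed
  also have "\<dots> = (\<Sum>j<n. LINT z|haar_Tinf. a j z * cnj (b j z))"
    by simp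
  finally show ?thesis .
qed

lemma code_weight_measurable: "code_weight \<in> borel_measurable haar_Tinf"
  using measurable_compose[OF trig_bounded(1)[OF trig_code_weight] borel_measurable_Re] by simp

lemma trig_const_untagged: "trig untagged (\<lambda>_. c)"
  by (rule trig_const) (simp add: untagged_def)

text \<open>Orthogonality of the carriers survives the untagged weight, so each of them contributes
  the integral of the weight.\<close>

lemma carrier_sum_energy:
  "(LINT z|haar_Tinf. code_weight z * (norm (carrier_sum z))\<^sup>2) = n * (LINT z|haar_Tinf. code_weight z)"
proof -
  have "complex_of_real (LINT z|haar_Tinf. code_weight z * (norm (carrier_sum z))\<^sup>2) =
    L2_pairing (\<lambda>z. \<Sum>j<n. carrier j z * of_real (code_weight z)) (\<lambda>z. \<Sum>j<n. carrier j z * 1)"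
    unfolding L2_pairing_def integral_complex_of_real[symmetric]
    by (intro Bochner_Integration.integral_cong)
      (simp_all only: of_real_mult complex_norm_square carrier_sum_def sum_distrib_right[symmetric]
        mult_1_right mult.assoc mult.left_commute[of "of_real (code_weight _)"])
  also have "\<dots> = of_real (n * (LINT z|haar_Tinf. code_weight z))"
    using L2_pairing_carriers[OF trig_code_weight trig_const_untagged[of 1]]
    by (simp add: integral_complex_of_real)
  finally show ?thesis by (simp only: of_real_eq_iff)
qed

text \<open>Orthogonality leaves one integral of \<open>proj_coeff j\<close> against the weight per
  carrier, and \<open>Re_proj_coeff_ge\<close> bounds each from below.\<close>

lemma proj_pairing_ge:
  "n / 4 * (LINT z|haar_Tinf. (code_weight z)\<^sup>2) \<le>
    Re (L2_pairing proj (\<lambda>z. of_real (code_weight z) * carrier_sum z))"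
proof -
  have T: "trig untagged (\<lambda>z. proj_coeff j z * of_real (code_weight z))" for j
    by (rule trig_mult[OF trig_proj_coeff trig_code_weight]) (auto simp: untagged_def)
  have "L2_pairing proj (\<lambda>z. of_real (code_weight z) * carrier_sum z) =
      (\<Sum>j<n. LINT z|haar_Tinf. proj_coeff j z * of_real (code_weight z))"
    using L2_pairing_carriers[OF trig_proj_coeff trig_code_weight]
    by (simp add: carrier_sum_def sum_distrib_left proj_def[abs_def] mult_ac)
  then have "Re (L2_pairing proj (\<lambda>z. of_real (code_weight z) * carrier_sum z)) =
      (\<Sum>j<n. LINT z|haar_Tinf. Re (proj_coeff j z * of_real (code_weight z)))"
    using integral_Re[OF trig_integrable[OF T]] by simp
  moreover have "(LINT z|haar_Tinf. (code_weight z)\<^sup>2) / 4 \<le> (LINT z|haar_Tinf. Re (proj_coeff j z * of_real (code_weight z)))"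
    if "j < n" for j
    unfolding Bochner_Integration.integral_divide_zero[symmetric]
  proof (rule integral_mono)
    show "integrable haar_Tinf (\<lambda>z. (code_weight z)\<^sup>2 / 4)"
      using code_weight_measurable code_weight_bounds
      by (intro integrable_bounded_haar[where B = 1]) (auto simp: abs_square_le_1 power_le_one intro: order.trans[of _ 1])
    show "integrable haar_Tinf (\<lambda>z. Re (proj_coeff j z * of_real (code_weight z)))"
      by (rule integrable_Re[OF trig_integrable[OF T]])
    fix z assume z: "z \<in> space haar_Tinf"
    show "(code_weight z)\<^sup>2 / 4 \<le> Re (proj_coeff j z * of_real (code_weight z))"
      using mult_right_mono[OF Re_proj_coeff_ge[OF z that] code_weight_bounds(1)[OF z]]
      by (simp add: power2_eq_square)
  qed
  ultimately show ?thesis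
    using sum_mono[of "{..<n}" "\<lambda>_. (LINT z|haar_Tinf. (code_weight z)\<^sup>2) / 4"] by simp
qed

text \<open>Confining the spectrum to the phases of the block later makes different blocks
  orthogonal although they share cube variables.\<close>

lemma trig_proj_tagged: "trig (\<Union>j<n. tagged (w j)) proj"
  unfolding proj_def[abs_def]
  by (intro trig_sum trig_mono[OF trig_carrier_mult[OF _ trig_proj_coeff]]) auto

lemma trig_test_tagged: "trig (\<Union>j<n. tagged (w j)) (\<lambda>z. of_real (code_weight z) * carrier_sum z)"
  unfolding carrier_sum_def sum_distrib_left
  by (subst mult.commute) (intro trig_sum trig_mono[OF trig_carrier_mult[OF _ trig_code_weight]], auto)

lemma trig_symbol: "trig UNIV symbol"
  by (rule trig.add[OF trig_mono[OF trig_proj] trig_mono[OF trig_symbol_minus_proj]]) auto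

lemma trig_carrier_sum: "trig UNIV carrier_sum"
  unfolding carrier_sum_def[abs_def] by (intro trig_sum trig_mono[OF trig_carrier]) auto

end

section \<open>Large norms\<close>

lemma sum_squares_le_square_sum:
  fixes f :: "'a \<Rightarrow> real"
  assumes "finite A" "\<And>x. x \<in> A \<Longrightarrow> 0 \<le> f x"
  shows "(\<Sum>x\<in>A. (f x)\<^sup>2) \<le> (\<Sum>x\<in>A. f x)\<^sup>2"
proof -
  have "(\<Sum>x\<in>A. f x * f x) \<le> (\<Sum>x\<in>A. f x * (\<Sum>x\<in>A. f x))"
    using assms by (intro sum_mono mult_left_mono member_le_sum) auto
  then show ?thesis by (simp add: power2_eq_square sum_distrib_right)
qed

text \<open>The codes of the \<open>2 * n + 1\<close> residues partition the cube.\<close>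

lemma sum_vt_code: "(\<Sum>a<2*n+1. \<Sum>S\<in>vt_code n a. h S) = (\<Sum>S\<in>Pow {..<n}. h S)"
  unfolding vt_code_def by (rule sum.group) auto

text \<open>The masses \<open>M a\<close> of the residue classes sum to 1, and their squares to at
  least the collision probability of two patterns, which is near 1 for values near the signs. The
  combination \<open>2 * (M a)\<^sup>2 - M a\<close> is the one that the later norm estimate
  needs.\<close>

lemma vt_code_concentration:
  fixes x :: "nat \<Rightarrow> real" and n :: nat
  assumes x: "\<And>i. \<bar>x i\<bar> \<le> 1"
  defines "M \<equiv> \<lambda>a. \<Sum>S\<in>vt_code n a. pattern_weight {..<n} x S"
  shows "1 - (\<Sum>i<n. 1 - (x i)\<^sup>2) \<le> (\<Sum>a<2*n+1. 2 * (M a)\<^sup>2 - M a)"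
proof -
  have x2: "(x i)\<^sup>2 \<le> 1" for i using x[of i] by (simp add: abs_square_le_1)
  have fin: "finite (vt_code n a)" for a unfolding vt_code_def by simp
  have "1 - (\<Sum>i<n. (1 - (x i)\<^sup>2) / 2) \<le> (\<Prod>i<n. 1 - (1 - (x i)\<^sup>2) / 2)"
    using x2 by (intro prod_ge_1_minus_sum) (auto intro: order.trans[OF _ zero_le_power2])
  also have "\<dots> = (\<Prod>i<n. (1 + (x i)\<^sup>2) / 2)"
    by (rule prod.cong) (auto simp: field_simps)
  also have "\<dots> = (\<Sum>a<2*n+1. \<Sum>S\<in>vt_code n a. (pattern_weight {..<n} x S)\<^sup>2)"
    by (simp only: sum_vt_code sum_pattern_weight_squared finite_lessThan)
  also have "\<dots> \<le> (\<Sum>a<2*n+1. (M a)\<^sup>2)"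
    unfolding M_def using fin by (intro sum_mono sum_squares_le_square_sum pattern_weight_nonneg x)
  finally have "1 - (\<Sum>i<n. 1 - (x i)\<^sup>2) / 2 \<le> (\<Sum>a<2*n+1. (M a)\<^sup>2)"
    by (simp only: sum_divide_distrib)
  moreover have "(\<Sum>a<2*n+1. M a) = 1"
    unfolding M_def by (simp only: sum_vt_code sum_pattern_weight finite_lessThan)
  then have "(\<Sum>a<2*n+1. 2 * (M a)\<^sup>2 - M a) = 2 * (\<Sum>a<2*n+1. (M a)\<^sup>2) - 1"
    by (simp only: sum_subtractf sum_distrib_left)
  ultimately show ?thesis by argo
qed

text \<open>
  \<open>f\<close> is a bounded symbol and \<open>g\<close> its Riesz projection; \<open>M\<close> is a smoothed indicator of the set on which
  \<open>g\<close> is large, and \<open>W\<close>, a sum of orthogonal carriers, detects this when \<open>g\<close> is paired with \<open>M W\<close>.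
\<close>

definition good_block ::
    "nat \<Rightarrow> (nat \<Rightarrow> nat) \<Rightarrow> ((nat \<Rightarrow> complex) \<Rightarrow> complex) \<Rightarrow> ((nat \<Rightarrow> complex) \<Rightarrow> complex) \<Rightarrow>
      ((nat \<Rightarrow> complex) \<Rightarrow> real) \<Rightarrow> ((nat \<Rightarrow> complex) \<Rightarrow> complex) \<Rightarrow> bool" where
  "good_block n w f g M W \<longleftrightarrow>
     f \<in> borel_measurable haar_Tinf \<and> (\<forall>z\<in>space haar_Tinf. norm (f z) \<le> 1) \<and>
     trig analytic_indices g \<and> trig (- analytic_indices) (\<lambda>z. f z - g z) \<and>
     trig (\<Union>j<n. tagged (w j)) g \<and> trig (\<Union>j<n. tagged (w j)) (\<lambda>z. of_real (M z) * W z) \<and>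
     trig UNIV W \<and> M \<in> borel_measurable haar_Tinf \<and>
     (\<forall>z\<in>space haar_Tinf. 0 \<le> M z \<and> M z \<le> 1) \<and>
     (LINT z|haar_Tinf. M z * (norm (W z))\<^sup>2) = n * (LINT z|haar_Tinf. M z) \<and>
     n / 4 * (LINT z|haar_Tinf. (M z)\<^sup>2) \<le> Re (L2_pairing g (\<lambda>z. of_real (M z) * W z)) \<and>
     1 / (2 * (2 * n + 1)) \<le> (LINT z|haar_Tinf. 2 * (M z)\<^sup>2 - M z)"

text \<open>The code is picked by averaging: \<open>vt_code_concentration\<close>, integrated, gives
  the \<open>2 * n + 1\<close> residues a total of at least 1/2, so one of them gets its share. The
  other requirements hold for every residue.\<close>

lemma good_block_exists:
  assumes n: "0 < n" and w: "\<And>j. j < n \<Longrightarrow> odd (w j)" "inj_on w {..<n}"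
  shows "\<exists>f g M W. good_block n w f g M W"
proof -
  \<comment> \<open>This accuracy keeps the integral of the sum of all \<open>n\<close> defects at
    most 1/2.\<close>
  have "0 < 1 / (2 * real n)" using n by simp
  then obtain k where k: "\<And>i. (LINT z|haar_Tinf. 1 - (sgn_approx k (Re (z i)))\<^sup>2) \<le> 1 / (2 * real n)"
    using sgn_approx_defect_integral by blast
  obtain Q where Q: "coeff Q 0 = 0"
      "\<And>\<zeta>. norm \<zeta> = 1 \<Longrightarrow> complex_of_real (sgn_approx k (Re \<zeta>)) = poly Q \<zeta> + cnj (poly Q \<zeta>)"
    using sgn_approx_circle[of k] by blast
  have rb: "riesz_block n w k Q (vt_code n a)" for a
    by unfold_locales (use w Q inj_on_flip_vt_code in \<open>auto simp: vt_code_def\<close>)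
  define x where "x z i = sgn_approx k (Re (z (2 * i)))" for z :: "nat \<Rightarrow> complex" and i
  define M where "M a z = (\<Sum>S\<in>vt_code n a. pattern_weight {..<n} (x z) S)" for a z
  have M_eq: "riesz_block.code_weight n k (vt_code n a) = M a" for a
    by (simp add: fun_eq_iff M_def x_def[abs_def] riesz_block.code_weight_def[OF rb] riesz_block.sign_var_def[OF rb, abs_def])
  note Mm = riesz_block.code_weight_measurable[OF rb, unfolded M_eq]
  note Mb = riesz_block.code_weight_bounds[OF rb, unfolded M_eq]
  have x1: "\<bar>x z i\<bar> \<le> 1" if "z \<in> space haar_Tinf" for z i
    using riesz_block.abs_sign_var[OF rb that] by (simp add: x_def riesz_block.sign_var_def[OF rb])
  have Mi: "integrable haar_Tinf (\<lambda>z. 2 * (M a z)\<^sup>2 - M a z)" for a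
  proof (rule integrable_bounded_haar)
    show "(\<lambda>z. 2 * (M a z)\<^sup>2 - M a z) \<in> borel_measurable haar_Tinf" using Mm[of a] by measurable
    fix z assume "z \<in> space haar_Tinf"
    then have "0 \<le> M a z" "M a z \<le> 1" "0 \<le> (M a z)\<^sup>2" "(M a z)\<^sup>2 \<le> 1"
      using Mb[of z a] by (auto simp: power_le_one)
    then show "norm (2 * (M a z)\<^sup>2 - M a z) \<le> 3"
      unfolding real_norm_def abs_le_iff by linarith
  qed
  have xi: "integrable haar_Tinf (\<lambda>z. 1 - (x z i)\<^sup>2)" for i
  proof (rule integrable_bounded_haar)
    show "(\<lambda>z. 1 - (x z i)\<^sup>2) \<in> borel_measurable haar_Tinf"
      unfolding x_def
      by (intro measurable_continuous_component_haar[of "\<lambda>\<zeta>. 1 - (sgn_approx k (Re \<zeta>))\<^sup>2"]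
          continuous_intros continuous_sgn_approx_Re)
    show "norm (1 - (x z i)\<^sup>2) \<le> 1" if "z \<in> space haar_Tinf" for z
      using x1[OF that, of i] by (simp add: abs_square_le_1)
  qed
  have xsum: "integrable haar_Tinf (\<lambda>z. \<Sum>i<n. 1 - (x z i)\<^sup>2)"
    by (rule Bochner_Integration.integrable_sum) (rule xi)
  have "1 - n * (1 / (2 * real n)) \<le> 1 - (\<Sum>i<n. LINT z|haar_Tinf. 1 - (x z i)\<^sup>2)"
    using sum_mono[of "{..<n}" "\<lambda>i. LINT z|haar_Tinf. 1 - (x z i)\<^sup>2" "\<lambda>_. 1 / (2 * real n)"] k
    by (simp add: x_def)
  also have "\<dots> = (LINT z|haar_Tinf. 1 - (\<Sum>i<n. 1 - (x z i)\<^sup>2))"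
    using haar.prob_space
    by (simp only: Bochner_Integration.integral_diff[OF haar.integrable_const xsum] Bochner_Integration.integral_sum[OF xi]) simp
  also have "\<dots> \<le> (LINT z|haar_Tinf. (\<Sum>a<2*n+1. 2 * (M a z)\<^sup>2 - M a z))"
  proof (rule integral_mono)
    show "integrable haar_Tinf (\<lambda>z. 1 - (\<Sum>i<n. 1 - (x z i)\<^sup>2))"
      by (intro Bochner_Integration.integrable_diff xsum) simp
    show "integrable haar_Tinf (\<lambda>z. \<Sum>a<2*n+1. 2 * (M a z)\<^sup>2 - M a z)"
      using Mi by (intro Bochner_Integration.integrable_sum)
    show "1 - (\<Sum>i<n. 1 - (x z i)\<^sup>2) \<le> (\<Sum>a<2*n+1. 2 * (M a z)\<^sup>2 - M a z)" if "z \<in> space haar_Tinf" for z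
      unfolding M_def by (rule vt_code_concentration) (rule x1[OF that])
  qed
  also have "\<dots> = (\<Sum>a<2*n+1. LINT z|haar_Tinf. 2 * (M a z)\<^sup>2 - M a z)"
    using Mi by (intro Bochner_Integration.integral_sum)
  finally have half: "1 / 2 \<le> (\<Sum>a<2*n+1. LINT z|haar_Tinf. 2 * (M a z)\<^sup>2 - M a z)"
    using n by simp
  have "\<exists>a<2*n+1. 1 / (2 * (2 * n + 1)) \<le> (LINT z|haar_Tinf. 2 * (M a z)\<^sup>2 - M a z)"
  proof (rule ccontr)
    assume "\<not> ?thesis"
    then have "(\<Sum>a<2*n+1. LINT z|haar_Tinf. 2 * (M a z)\<^sup>2 - M a z) < (\<Sum>a<2*n+1. 1 / (2 * (2 * real n + 1)))"
      by (intro sum_strict_mono) (auto simp: not_le add.commute)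
    also have "\<dots> = 1 / 2" by (simp add: field_simps)
    finally show False using half by simp
  qed
  then obtain a where a: "1 / (2 * (2 * n + 1)) \<le> (LINT z|haar_Tinf. 2 * (M a z)\<^sup>2 - M a z)" by blast
  interpret riesz_block n w k Q "vt_code n a" by (rule rb)
  have "good_block n w symbol proj code_weight carrier_sum"
    unfolding good_block_def
    using trig_bounded(1)[OF trig_symbol] norm_symbol trig_proj trig_symbol_minus_proj trig_proj_tagged
      trig_test_tagged trig_carrier_sum code_weight_measurable code_weight_bounds carrier_sum_energy
      proj_pairing_ge a[folded M_eq]
    by blast
  then show ?thesis by blast
qed

text \<open>When \<open>t\<^sup>2\<close> exceeds the threshold \<open>T\<close>, the factor
  \<open>(t\<^sup>2 / T) powr (r/2 - 1)\<close> is at least 1 and turns the square into an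
  \<open>r\<close>-th power.\<close>

lemma square_le_split:
  fixes t T r :: real
  assumes "0 \<le> t" "0 < T" "2 < r"
  shows "t\<^sup>2 \<le> T + T powr (1 - r/2) * t powr r"
proof (cases "t\<^sup>2 \<le> T")
  case True
  then show ?thesis by (simp add: add_increasing2)
next
  case False
  then have t: "0 < t" using assms by (cases "t = 0") auto
  have "1 \<le> (t\<^sup>2 / T) powr (r/2 - 1)"
    using False assms by (intro ge_one_powr_ge_zero) (auto simp: field_simps)
  also have "\<dots> = (t\<^sup>2) powr (r/2 - 1) * T powr (1 - r/2)"
  proof -
    have "T powr (1 - r/2) = inverse (T powr (r/2 - 1))"
      using powr_minus[of T "r/2 - 1"] by simp
    moreover have "(t\<^sup>2 / T) powr (r/2 - 1) = (t\<^sup>2) powr (r/2 - 1) / T powr (r/2 - 1)"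
      by (rule powr_divide)
    ultimately show ?thesis by (simp only: divide_inverse)
  qed
  also have "(t\<^sup>2) powr (r/2 - 1) = t powr (r - 2)"
  proof -
    have "(t\<^sup>2) powr (r/2 - 1) = (t powr 2) powr (r/2 - 1)" using t by simp
    also have "\<dots> = t powr (r - 2)" by (simp add: powr_powr right_diff_distrib)
    finally show ?thesis .
  qed
  finally have "t\<^sup>2 * 1 \<le> t\<^sup>2 * (t powr (r - 2) * T powr (1 - r/2))"
    by (intro mult_left_mono) auto
  also have "\<dots> = T powr (1 - r/2) * t powr r"
    using t by (simp add: powr_diff)
  finally show ?thesis using assms(2) by simp
qed

text \<open>Testing against the product of \<open>M\<close> and \<open>W\<close> bounds the
  \<open>M\<close>-weighted integral of the square of \<open>norm (G z)\<close> below by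
  \<open>T * (4 * E2 - E1)\<close>. Values with square at most \<open>T\<close> account for at most
  \<open>T * E1\<close> of it; the rest must come from the \<open>r\<close>-th power.\<close>

lemma good_block_lower_bound:
  assumes blk: "good_block n w f g M W" and n: "0 < n" and c: "0 < c" and r: "2 < r"
    and G: "G \<in> Lp_Tinf 2" and Gr: "integrable haar_Tinf (\<lambda>z. norm (G z) powr r)"
    and pair: "L2_pairing G (\<lambda>z. of_real (M z) * W z) = of_real c * L2_pairing g (\<lambda>z. of_real (M z) * W z)"
  shows "(c\<^sup>2 * n / 64) powr (r/2) \<le> (2 * n + 1) * (LINT z|haar_Tinf. norm (G z) powr r)"
proof -
  define T where "T = c\<^sup>2 * n / 64"
  define I where "I = (LINT z|haar_Tinf. norm (G z) powr r)"
  have T: "0 < T" using n c by (simp add: T_def)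
  have [measurable]: "M \<in> borel_measurable haar_Tinf" "W \<in> borel_measurable haar_Tinf" "G \<in> borel_measurable haar_Tinf"
    using blk G trig_bounded(1)[of UNIV W] by (auto simp: good_block_def Lp_2_iff)
  have Mb: "0 \<le> M z" "M z \<le> 1" if "z \<in> space haar_Tinf" for z
    using blk that by (auto simp: good_block_def)
  have MW: "(\<lambda>z. of_real (M z) * W z) \<in> Lp_Tinf 2"
    using blk trig_Lp_2 by (auto simp: good_block_def)
  have Mint: "integrable haar_Tinf (\<lambda>z. M z * h z)"
    if "integrable haar_Tinf h" "\<And>z. 0 \<le> h z" for h :: "_ \<Rightarrow> real"
  proof (rule Bochner_Integration.integrable_bound[OF that(1)])
    show "AE z in haar_Tinf. norm (M z * h z) \<le> norm (h z)"
      using Mb that(2) by (intro AE_I2) (simp add: abs_mult mult_left_le_one_le)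
  qed (use that in measurable)
  have W2: "integrable haar_Tinf (\<lambda>z. (norm (W z))\<^sup>2)"
    using blk trig_Lp_2[of UNIV W] by (auto simp: good_block_def Lp_2_iff)
  have G2: "integrable haar_Tinf (\<lambda>z. (norm (G z))\<^sup>2)" using G by (simp add: Lp_2_iff)
  note MW2 = Mint[OF W2] and MG2 = Mint[OF G2]
  have M1: "integrable haar_Tinf M" using Mint[of "\<lambda>_. 1"] by simp
  have M2: "integrable haar_Tinf (\<lambda>z. (M z)\<^sup>2)"
    using Mb by (intro integrable_bounded_haar[where B = 1]) (auto simp: power_le_one)
  define E1 where "E1 = (LINT z|haar_Tinf. M z)"
  define E2 where "E2 = (LINT z|haar_Tinf. (M z)\<^sup>2)"
  define EG where "EG = (LINT z|haar_Tinf. M z * (norm (G z))\<^sup>2)"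
  have "c * (n / 4 * E2) \<le> c * Re (L2_pairing g (\<lambda>z. of_real (M z) * W z))"
    using blk c by (intro mult_left_mono) (auto simp: good_block_def E2_def)
  also have "\<dots> = Re (LINT z|haar_Tinf. G z * cnj (of_real (M z) * W z))"
    using pair by (simp add: L2_pairing_def)
  also have "\<dots> = (LINT z|haar_Tinf. Re (G z * cnj (of_real (M z) * W z)))"
    by (rule integral_Re[OF integrable_L2_pairing[OF G MW], symmetric])
  \<comment> \<open>The weights \<open>c / 16\<close> and \<open>4 / c\<close> have product 1/4, as
    the inequality of arithmetic and geometric means requires. The first is small enough for the
    \<open>W\<close> term to cost only a quarter of the lower bound when \<open>E1\<close> and
    \<open>E2\<close> are close.\<close>
  also have "\<dots> \<le> (LINT z|haar_Tinf. c / 16 * (M z * (norm (W z))\<^sup>2) + 4 / c * (M z * (norm (G z))\<^sup>2))"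
  proof (rule integral_mono)
    show "integrable haar_Tinf (\<lambda>z. Re (G z * cnj (of_real (M z) * W z)))"
      by (rule integrable_Re[OF integrable_L2_pairing[OF G MW]])
    show "integrable haar_Tinf (\<lambda>z. c / 16 * (M z * (norm (W z))\<^sup>2) + 4 / c * (M z * (norm (G z))\<^sup>2))"
      using MW2 MG2 by simp
    fix z assume z: "z \<in> space haar_Tinf"
    have "Re (G z * cnj (of_real (M z) * W z)) \<le> M z * (norm (G z) * norm (W z))"
      using complex_Re_le_cmod[of "G z * cnj (of_real (M z) * W z)"] Mb[OF z]
      by (simp add: norm_mult mult_ac)
    also have "\<dots> \<le> M z * (c / 16 * (norm (W z))\<^sup>2 + 4 / c * (norm (G z))\<^sup>2)"
    proof (rule mult_left_mono[OF _ Mb(1)[OF z]])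
      have "0 \<le> 4 / c * (c / 8 * norm (W z) - norm (G z))\<^sup>2" using c by simp
      also have "\<dots> = c / 16 * (norm (W z))\<^sup>2 + 4 / c * (norm (G z))\<^sup>2 - norm (G z) * norm (W z)"
        using c by (simp add: power2_eq_square field_simps)
      finally show "norm (G z) * norm (W z) \<le> c / 16 * (norm (W z))\<^sup>2 + 4 / c * (norm (G z))\<^sup>2"
        by simp
    qed
    finally show "Re (G z * cnj (of_real (M z) * W z)) \<le>
        c / 16 * (M z * (norm (W z))\<^sup>2) + 4 / c * (M z * (norm (G z))\<^sup>2)"
      by (simp add: algebra_simps)
  qed
  also have "\<dots> = c / 16 * (n * E1) + 4 / c * EG"
    using MW2 MG2 blk by (simp add: good_block_def E1_def EG_def)
  finally have "T * (4 * E2 - E1) \<le> EG"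
    using c by (simp add: T_def power2_eq_square field_simps)
  moreover have "EG \<le> (LINT z|haar_Tinf. T * M z + T powr (1 - r/2) * norm (G z) powr r)"
    unfolding EG_def
  proof (rule integral_mono)
    show "integrable haar_Tinf (\<lambda>z. M z * (norm (G z))\<^sup>2)" using MG2 by simp
    show "integrable haar_Tinf (\<lambda>z. T * M z + T powr (1 - r/2) * norm (G z) powr r)"
      using M1 Gr by simp
    fix z assume z: "z \<in> space haar_Tinf"
    have "M z * (norm (G z))\<^sup>2 \<le> M z * (T + T powr (1 - r/2) * norm (G z) powr r)"
      by (intro mult_left_mono square_le_split Mb[OF z] T r) simp
    moreover have "M z * (T powr (1 - r/2) * norm (G z) powr r) \<le> T powr (1 - r/2) * norm (G z) powr r"
      using Mb[OF z] by (intro mult_left_le_one_le) auto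
    ultimately show "M z * (norm (G z))\<^sup>2 \<le> T * M z + T powr (1 - r/2) * norm (G z) powr r"
      by (simp add: algebra_simps)
  qed
  moreover have "\<dots> = T * E1 + T powr (1 - r/2) * I"
    using M1 Gr by (simp add: E1_def I_def)
  ultimately have "2 * T * (2 * E2 - E1) \<le> T powr (1 - r/2) * I"
    by (simp add: algebra_simps)
  moreover have "1 / (2 * (2 * n + 1)) \<le> 2 * E2 - E1"
    using blk M1 M2 by (simp add: good_block_def E1_def E2_def)
  then have "2 * T * (1 / (2 * (2 * n + 1))) \<le> 2 * T * (2 * E2 - E1)"
    using T by (intro mult_left_mono) auto
  moreover have "2 * T * (1 / (2 * (2 * n + 1))) = T / (2 * n + 1)" by (simp add: field_simps)
  ultimately have "T / (2 * n + 1) \<le> T powr (1 - r/2) * I" by linarith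
  then have "T powr (r/2 - 1) * (T / (2 * n + 1)) \<le> T powr (r/2 - 1) * (T powr (1 - r/2) * I)"
    by (intro mult_left_mono) auto
  moreover have "T powr (r/2 - 1) * T = T powr (r/2)" using T by (simp add: powr_diff)
  moreover have "T powr (r/2 - 1) * T powr (1 - r/2) = 1" using T by (simp flip: powr_add)
  ultimately have "T powr (r/2) / (2 * n + 1) \<le> I"
    by (simp flip: mult.assoc) 
  then show ?thesis
    unfolding T_def[symmetric] I_def[symmetric] by (simp add: field_simps)
qed

text \<open>For \<open>p = \<infinity>\<close> any finite exponent above 2 serves; 3 is
  taken.\<close>

lemma Lp_imp_powr_integrable:
  assumes "2 < p" "G \<in> Lp_Tinf p"
  shows "integrable haar_Tinf (\<lambda>z. norm (G z) powr (if p = \<infinity> then 3 else enn2real p))"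
proof (cases "p = \<infinity>")
  case True
  then obtain C where C: "AE z in haar_Tinf. norm (G z) \<le> C" and [measurable]: "G \<in> borel_measurable haar_Tinf"
    using assms(2) by (auto simp: Lp_Tinf_def)
  have "integrable haar_Tinf (\<lambda>z. norm (G z) powr 3)"
  proof (rule haar.integrable_const_bound[where B = "C powr 3"])
    show "AE z in haar_Tinf. norm (norm (G z) powr 3) \<le> C powr 3"
      using C
    proof eventually_elim
      case (elim z)
      have "norm (G z) powr 3 \<le> C powr 3" using elim by (intro powr_mono2) auto
      then show ?case by simp
    qed
  qed measurable
  then show ?thesis using True by simp
qed (use assms in \<open>auto simp: Lp_Tinf_def\<close>)

section \<open>Gluing the blocks into one bounded symbol\<close>

theorem corollary2p3:
  fixes p :: ennreal
  assumes "2 < p"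
  shows "\<not> H1_dual \<subseteq> Hp_Tinf p"
proof
  assume sub: "H1_dual \<subseteq> Hp_Tinf p"
  define r where "r = (if p = \<infinity> then 3 else enn2real p)"
  have r: "2 < r"
  proof (cases "p = \<infinity>")
    case False
    then have "p < top" by (simp add: less_top)
    then have "enn2real 2 < enn2real p"
      using assms by (subst enn2real_less_iff) auto
    then show ?thesis using False by (simp add: r_def)
  qed (simp add: r_def)
  \<comment> \<open>With \<open>K powr (r/2 - 1)\<close> at least 8, a factor 4 per block pays for
    the growth of \<open>n m\<close> beyond \<open>K ^ m\<close>, and a factor 2 is left to
    diverge.\<close>
  define K where "K = nat \<lceil>8 powr (2 / (r - 2))\<rceil>"
  have K8: "8 powr (2 / (r - 2)) \<le> real K" by (simp add: K_def)
  have "0 < 8 powr (2 / (r - 2))" by simp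
  then have K0: "0 < real K" using K8 by linarith
  have K: "8 \<le> real K powr (r/2 - 1)"
  proof -
    have "(2 / (r - 2)) * (r/2 - 1) = 1" using r by (simp add: field_simps)
    then have "8 = (8 powr (2 / (r - 2))) powr (r/2 - 1)" by (simp add: powr_powr)
    also have "\<dots> \<le> real K powr (r/2 - 1)" using K8 r by (intro powr_mono2) auto
    finally show ?thesis .
  qed
  \<comment> \<open>The amplitude \<open>(1/2)^m\<close> costs a factor \<open>4 ^ m\<close> in mean
    square; this size makes the threshold of block \<open>m\<close> equal to
    \<open>K ^ m\<close>.\<close>
  define n where "n m = 64 * (4 * K) ^ m" for m
  have n0: "0 < n m" for m using K0 by (simp add: n_def)
  \<comment> \<open>Encoding the block number with the position makes all phase coordinates
    distinct, across blocks as well.\<close>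
  define w where "w m j = 2 * prod_encode (m, j) + 1" for m j
  have "\<exists>f g M W. good_block (n m) (w m) f g M W" for m
    by (rule good_block_exists[OF n0]) (auto simp: w_def intro!: inj_onI)
  then obtain f g M W where blk: "\<And>m. good_block (n m) (w m) (f m) (g m) (M m) (W m)"
    by metis
  define G where "G z = (\<Sum>m. (1/2)^m * g m z)" for z
  have fm: "f m \<in> borel_measurable haar_Tinf" and f1: "z \<in> space haar_Tinf \<Longrightarrow> norm (f m z) \<le> 1"
    and g: "trig analytic_indices (g m)" and fg: "trig (- analytic_indices) (\<lambda>z. f m z - g m z)" for m z
    using blk[of m] by (auto simp: good_block_def)
  have "G \<in> riesz_image_Linf"
    unfolding G_def[abs_def] by (rule riesz_image_series(1)[OF fm _ g fg]) (rule f1)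
  have G2: "G \<in> Lp_Tinf 2"
    unfolding G_def[abs_def] by (rule riesz_image_series(2)[OF fm _ g fg]) (rule f1)
  have GS: "(\<lambda>m. (1/2)^m * L2_pairing (g m) h) sums L2_pairing G h" if "h \<in> Lp_Tinf 2" for h
    unfolding G_def[abs_def] by (rule riesz_image_series(3)[OF fm _ g fg that]) (rule f1)
  have "G \<in> Hp_Tinf p" using \<open>G \<in> riesz_image_Linf\<close> sub by (auto simp: H1_dual_eq)
  then have Gr: "integrable haar_Tinf (\<lambda>z. norm (G z) powr r)"
    using Lp_imp_powr_integrable[OF assms, of G] by (simp add: Hp_Tinf_def r_def)
  define I where "I = (LINT z|haar_Tinf. norm (G z) powr r)"
  \<comment> \<open>The constant is 3 times 64, from \<open>2 * n m + 1 \<le> 3 * n m\<close> and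
    the factor 64 in \<open>n m\<close>.\<close>
  have I: "2 ^ m \<le> 192 * I" for m
  proof -
    define V where "V z = of_real (M m z) * W m z" for z
    have V: "trig (\<Union>j<n m. tagged (w m j)) V"
      using blk[of m] by (simp add: good_block_def V_def[abs_def])
    \<comment> \<open>Testing with \<open>V\<close> isolates block \<open>m\<close>, whose phases no
      other block uses.\<close>
    have "L2_pairing (g l) V = 0" if "l \<noteq> m" for l
    proof (rule trig_orthogonal[OF _ V])
      show "trig (\<Union>j<n l. tagged (w l j)) (g l)"
        using blk[of l] by (simp add: good_block_def)
      have "w l i \<noteq> w m j" "odd (w l i)" for i j
        using that by (auto simp: w_def prod_encode_eq)
      then show "(\<Union>j<n l. tagged (w l j)) \<inter> (\<Union>j<n m. tagged (w m j)) = {}"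
        using tagged_disjoint by blast
    qed
    then have "(\<lambda>l. (1/2)^l * L2_pairing (g l) V) = (\<lambda>l. if l = m then (1/2)^l * L2_pairing (g l) V else 0)"
      by auto
    then have "(\<lambda>l. (1/2)^l * L2_pairing (g l) V) sums ((1/2)^m * L2_pairing (g m) V)"
      using sums_single[of m "\<lambda>l. (1/2)^l * L2_pairing (g l) V"] by simp
    then have pair: "L2_pairing G V = of_real ((1/2)^m) * L2_pairing (g m) V"
      using sums_unique2[OF GS[OF trig_Lp_2[OF V]]] by simp
    have "(((1/2)^m)\<^sup>2 * n m / 64) powr (r/2) \<le> (2 * real (n m) + 1) * I"
      unfolding I_def by (rule good_block_lower_bound[OF blk n0 _ r G2 Gr pair[unfolded V_def[abs_def]]]) simp
    moreover have "((1/2)^m)\<^sup>2 * n m / 64 = real K ^ m"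
    proof -
      have "(4::real) ^ m = 2 ^ m * 2 ^ m" by (simp flip: power_mult_distrib)
      then show ?thesis by (simp add: n_def power2_eq_square power_mult_distrib power_divide)
    qed
    ultimately have le: "(real K ^ m) powr (r/2) \<le> (2 * real (n m) + 1) * I" by simp
    have I0: "0 \<le> I" unfolding I_def by (rule integral_nonneg_AE) simp
    have "(8::real) ^ m = 2 ^ m * 4 ^ m" by (simp flip: power_mult_distrib)
    then have "2 ^ m * (4 ^ m * real K ^ m) = 8 ^ m * real K ^ m" by simp
    also have "\<dots> \<le> (real K powr (r/2 - 1)) ^ m * real K ^ m"
      using K by (intro mult_right_mono power_mono) auto
    also have "\<dots> = (real K powr (r/2 - 1) * real K) ^ m" by (simp add: power_mult_distrib)
    also have "\<dots> = (real K powr (r/2)) ^ m" using K0 by (simp add: powr_diff)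
    also have "\<dots> = (real K powr m) powr (r/2)"
      using K0 powr_realpow[of "real K powr (r/2)" m] by (simp add: powr_powr mult.commute)
    also have "\<dots> = (real K ^ m) powr (r/2)" using K0 by (simp add: powr_realpow)
    also have "\<dots> \<le> (2 * real (n m) + 1) * I" by (rule le)
    also have "\<dots> \<le> (3 * real (n m)) * I" using n0[of m] I0 by (intro mult_right_mono) auto
    also have "\<dots> = 192 * I * (4 ^ m * real K ^ m)" by (simp add: n_def power_mult_distrib)
    finally show ?thesis using K0 by (simp add: mult_le_cancel_right)
  qed
  obtain m where "192 * I < 2 ^ m" using real_arch_pow[of 2 "192 * I"] by auto
  then show False using I[of m] by simp
qed

end
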